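(* Let $f:\mathbb{R}^d\to\mathbb{R}$ be twice differentiable and $\mu$-strongly convex with $\mu>0$, let $\nabla f$ be Lipschitz continuous with constant $L>0$, and let $\nabla^2 f$ be Lipschitz continuous with constant $M>0$ (i.e. $\|\nabla^2f(x)-\nabla^2f(y)\|\le M\|x-y\|$ for all $x,y$). Let $\kappa=L/\mu$ and let $x_*$ be the minimizer of $f$. Let $\{x_t\}_{t\ge0}$ be generated by BFGS with step sizes satisfying the Armijo-Wolfe conditions with parameters $\alpha,\beta$ and chosen by the log bisection algorithm. Define $\sigma:=\left(\Psi(\bar B_0)+\frac{3}{\alpha(1-\beta)}\kappa\right)C_0$. Then for any initial point $x_0\in\mathbb{R}^d$, any symmetric positive definite $B_0$, and any $t\ge 1$, the average number $\Lambda_t$ of function value and gradient evaluations per iteration in the log bisection algorithm after $t$ iterations satisfies $$\Lambda_t\le2+\log_2\!\Big(1+\frac{1-\beta}{\beta-\alpha}+\frac{2(1-\beta)}{\beta-\alpha}\frac{\sigma}{t}\Big)+2\log_2\!\Big(\log_2\big(16(1-\alpha)\big)+\log_2\!\big(1+\frac{\sigma}{t}\big)+\frac{6\Psi(\tilde B_0)+12\sigma}{t}\Big).$$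
   Context: BFGS method: given $x_0\in\mathbb{R}^d$ and a symmetric positive definite $B_0\in\mathbb{R}^{d\times d}$, for $t\ge0$ set $g_t=\nabla f(x_t)$, $d_t=-B_t^{-1}g_t$, $x_{t+1}=x_t+\eta_t d_t$ with step size $\eta_t>0$, $s_t=x_{t+1}-x_t$, $y_t=\nabla f(x_{t+1})-\nabla f(x_t)$, and $$B_{t+1}=B_t-\frac{B_ts_ts_t^\top B_t}{s_t^\top B_ts_t}+\frac{y_ty_t^\top}{s_t^\top y_t}.$$ The iterates are assumed non-optimal ($g_t\neq0$), so that all quantities are well defined. Armijo-Wolfe conditions on $\eta_t$, with parameters $0<\alpha<\beta<1$ and $0<\alpha<\frac12$: the sufficient decrease condition $f(x_t+\eta_td_t)\le f(x_t)+\alpha\eta_t\nabla f(x_t)^\top d_t$ and the curvature condition $\nabla f(x_t+\eta_td_t)^\top d_t\ge\beta\nabla f(x_t)^\top d_t$. Log bisection algorithm (at iteration $t$ of BFGS): start with $\eta^{(0)}=1$, $\eta^{(0)}_{\min}=0$, $\eta^{(0)}_{\max}=+\infty$. For $i=0,1,2,\dots$: (1) if $f(x_t+\eta^{(i)}d_t)>f(x_t)+\alpha\eta^{(i)}\nabla f(x_t)^\top d_t$, set $\eta^{(i+1)}_{\max}=\eta^{(i)}$, $\eta^{(i+1)}_{\min}=\eta^{(i)}_{\min}$, and set $\eta^{(i+1)}=(\frac12)^{2^{i+1}-1}$ if $\eta^{(i)}_{\min}=0$, and $\eta^{(i+1)}=\sqrt{\eta^{(i+1)}_{\max}\eta^{(i+1)}_{\min}}$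 otherwise; (2) else, if $\nabla f(x_t+\eta^{(i)}d_t)^\top d_t<\beta\nabla f(x_t)^\top d_t$, set $\eta^{(i+1)}_{\max}=\eta^{(i)}_{\max}$, $\eta^{(i+1)}_{\min}=\eta^{(i)}$, and set $\eta^{(i+1)}=2^{2^{i+1}-1}$ if $\eta^{(i)}_{\max}=+\infty$, and $\eta^{(i+1)}=\sqrt{\eta^{(i+1)}_{\max}\eta^{(i+1)}_{\min}}$ otherwise; (3) else, return $\eta_t=\eta^{(i)}$. Each loop queries the function value and gradient at most once. Let $\lambda_t$ be the number of loops until the algorithm terminates at BFGS iteration $t$; then $\Lambda_t:=\frac1t\sum_{i=0}^{t-1}\lambda_i$ (the average number of function value and gradient evaluations per iteration is identified with the average number of loops per iteration). For symmetric positive definite $A\in\mathbb{R}^{d\times d}$, $\Psi(A):=\mathrm{Tr}(A)-d-\log\mathrm{Det}(A)$. Also $\bar B_0:=\frac1LB_0$, $\tilde B_0:=\nabla^2f(x_* )^{-1/2}B_0\nabla^2f(x_* )^{-1/2}$, and $C_t:=\frac{M}{\mu^{3/2}}\sqrt{2(f(x_t)-f(x_* ))}$ for $t\ge0$. *)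

theory Defs
  imports "HOL-Analysis.Analysis"
begin

section \<open>Functions\<close>

definition grad :: "(real ^ 'n \<Rightarrow> real) \<Rightarrow> real ^ 'n \<Rightarrow> real ^ 'n" where
  "grad f x = (THE D. GDERIV f x :> D)"

definition hess :: "(real ^ 'n \<Rightarrow> real) \<Rightarrow> real ^ 'n \<Rightarrow> real ^ 'n ^ 'n" where
  "hess f x = matrix (frechet_derivative (grad f) (at x))"

definition twice_differentiable :: "(real ^ 'n \<Rightarrow> real) \<Rightarrow> bool" where
  "twice_differentiable f \<longleftrightarrow>
     (\<forall>x. f differentiable (at x)) \<and> (\<forall>x. grad f differentiable (at x))"

definition strongly_convex :: "real \<Rightarrow> (real ^ 'n \<Rightarrow> real) \<Rightarrow> bool" where
  "strongly_convex \<mu> f \<longleftrightarrow>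
     (\<forall>x y u v. u \<ge> 0 \<longrightarrow> v \<ge> 0 \<longrightarrow> u + v = 1 \<longrightarrow>
        f (u *\<^sub>R x + v *\<^sub>R y) \<le> u * f x + v * f y - \<mu> / 2 * u * v * (norm (x - y))\<^sup>2)"

text \<open>
  Lipschitz continuity of the Hessian with respect to the spectral norm. The library's norm on
  matrices is the Frobenius norm, so the operator norm has to be taken explicitly.
\<close>
definition hessian_lipschitz :: "real \<Rightarrow> (real ^ 'n \<Rightarrow> real) \<Rightarrow> bool" where
  "hessian_lipschitz M f \<longleftrightarrow>
     (\<forall>x y. onorm (\<lambda>v. (hess f x - hess f y) *v v) \<le> M * norm (x - y))"

section \<open>Matrices\<close>

definition spd :: "real ^ 'n ^ 'n \<Rightarrow> bool" where
  "spd A \<longleftrightarrow> transpose A = A \<and> (\<forall>v. v \<noteq> 0 \<longrightarrow> v \<bullet> (A *v v) > 0)"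

text \<open>\<open>inv_sqrt A\<close> is the matrix \<open>A\<close> to the power \<open>-1/2\<close>, for symmetric positive definite \<open>A\<close>.\<close>
definition inv_sqrt :: "real ^ 'n ^ 'n \<Rightarrow> real ^ 'n ^ 'n" where
  "inv_sqrt A = (THE S. spd S \<and> S ** S = matrix_inv A)"

definition \<Psi> :: "real ^ 'n ^ 'n \<Rightarrow> real" where
  "\<Psi> A = trace A - real CARD('n) - ln (det A)"

definition outer :: "real ^ 'n \<Rightarrow> real ^ 'n \<Rightarrow> real ^ 'n ^ 'n" where
  "outer u v = (\<chi> i j. u $ i * v $ j)"

section \<open>Log bisection\<close>

definition sufficient_decrease ::
    "(real ^ 'n \<Rightarrow> real) \<Rightarrow> real \<Rightarrow> real ^ 'n \<Rightarrow> real ^ 'n \<Rightarrow> real \<Rightarrow> bool" where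
  "sufficient_decrease f \<alpha> x d \<eta> \<longleftrightarrow>
     f (x + \<eta> *\<^sub>R d) \<le> f x + \<alpha> * \<eta> * (grad f x \<bullet> d)"

definition curvature_condition ::
    "(real ^ 'n \<Rightarrow> real) \<Rightarrow> real \<Rightarrow> real ^ 'n \<Rightarrow> real ^ 'n \<Rightarrow> real \<Rightarrow> bool" where
  "curvature_condition f \<beta> x d \<eta> \<longleftrightarrow>
     grad f (x + \<eta> *\<^sub>R d) \<bullet> d \<ge> \<beta> * (grad f x \<bullet> d)"

text \<open>
  The state at the beginning of loop \<open>i\<close> is the triple of the trial step size, the lower bound and
  the upper bound. Once a trial step is accepted the state no longer changes.
\<close>
primrec log_bisection ::
    "(real ^ 'n \<Rightarrow> real) \<Rightarrow> real \<Rightarrow> real \<Rightarrow> real ^ 'n \<Rightarrow> real ^ 'n \<Rightarrow> nat \<Rightarrow> real \<times> real \<times> ereal"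
where
  "log_bisection f \<alpha> \<beta> x d 0 = (1, 0, \<infinity>)"
| "log_bisection f \<alpha> \<beta> x d (Suc i) =
     (case log_bisection f \<alpha> \<beta> x d i of (\<eta>, \<eta>min, \<eta>max) \<Rightarrow>
        if \<not> sufficient_decrease f \<alpha> x d \<eta> then
          (if \<eta>min = 0 then (1 / 2) ^ (2 ^ (i + 1) - 1) else sqrt (\<eta> * \<eta>min), \<eta>min, ereal \<eta>)
        else if \<not> curvature_condition f \<beta> x d \<eta> then
          (if \<eta>max = \<infinity> then 2 ^ (2 ^ (i + 1) - 1) else sqrt (real_of_ereal \<eta>max * \<eta>), \<eta>, \<eta>max)
        else (\<eta>, \<eta>min, \<eta>max))"

definition trial_step ::
    "(real ^ 'n \<Rightarrow> real) \<Rightarrow> real \<Rightarrow> real \<Rightarrow> real ^ 'n \<Rightarrow> real ^ 'n \<Rightarrow> nat \<Rightarrow> real" where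
  "trial_step f \<alpha> \<beta> x d i = fst (log_bisection f \<alpha> \<beta> x d i)"

definition returns_at ::
    "(real ^ 'n \<Rightarrow> real) \<Rightarrow> real \<Rightarrow> real \<Rightarrow> real ^ 'n \<Rightarrow> real ^ 'n \<Rightarrow> nat \<Rightarrow> bool" where
  "returns_at f \<alpha> \<beta> x d i \<longleftrightarrow>
     sufficient_decrease f \<alpha> x d (trial_step f \<alpha> \<beta> x d i) \<and>
     curvature_condition f \<beta> x d (trial_step f \<alpha> \<beta> x d i)"

text \<open>
  The number of executed loops. The loop that accepts the trial step is counted, and the
  value is infinite if the algorithm does not terminate.
\<close>
definition loops ::
    "(real ^ 'n \<Rightarrow> real) \<Rightarrow> real \<Rightarrow> real \<Rightarrow> real ^ 'n \<Rightarrow> real ^ 'n \<Rightarrow> enat" where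
  "loops f \<alpha> \<beta> x d =
     (if \<exists>i. returns_at f \<alpha> \<beta> x d i then enat (Suc (LEAST i. returns_at f \<alpha> \<beta> x d i)) else \<infinity>)"

text \<open>The returned step size; meaningful only if the algorithm terminates.\<close>
definition step_size ::
    "(real ^ 'n \<Rightarrow> real) \<Rightarrow> real \<Rightarrow> real \<Rightarrow> real ^ 'n \<Rightarrow> real ^ 'n \<Rightarrow> real" where
  "step_size f \<alpha> \<beta> x d = trial_step f \<alpha> \<beta> x d (LEAST i. returns_at f \<alpha> \<beta> x d i)"

section \<open>BFGS\<close>

definition direction :: "(real ^ 'n \<Rightarrow> real) \<Rightarrow> real ^ 'n \<Rightarrow> real ^ 'n ^ 'n \<Rightarrow> real ^ 'n" where
  "direction f x B = - (matrix_inv B *v grad f x)"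

definition bfgs_update ::
    "real ^ 'n ^ 'n \<Rightarrow> real ^ 'n \<Rightarrow> real ^ 'n \<Rightarrow> real ^ 'n ^ 'n" where
  "bfgs_update B s y =
     B - (1 / (s \<bullet> (B *v s))) *\<^sub>R (B ** outer s s ** B) + (1 / (s \<bullet> y)) *\<^sub>R outer y y"

text \<open>
  Termination of the line search is not built into this predicate: the recursion uses
  \<^const>\<open>step_size\<close> whether or not it is meaningful.
\<close>
definition bfgs_log_bisection ::
    "(real ^ 'n \<Rightarrow> real) \<Rightarrow> real \<Rightarrow> real \<Rightarrow> (nat \<Rightarrow> real ^ 'n) \<Rightarrow> (nat \<Rightarrow> real ^ 'n ^ 'n) \<Rightarrow> bool"
where
  "bfgs_log_bisection f \<alpha> \<beta> x B \<longleftrightarrow>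
     (\<forall>t. x (Suc t) = x t + step_size f \<alpha> \<beta> (x t) (direction f (x t) (B t)) *\<^sub>R direction f (x t) (B t) \<and>
          B (Suc t) = bfgs_update (B t) (x (Suc t) - x t) (grad f (x (Suc t)) - grad f (x t)))"

definition avg_loops ::
    "(real ^ 'n \<Rightarrow> real) \<Rightarrow> real \<Rightarrow> real \<Rightarrow> (nat \<Rightarrow> real ^ 'n) \<Rightarrow> (nat \<Rightarrow> real ^ 'n ^ 'n) \<Rightarrow> nat \<Rightarrow> ereal"
where
  "avg_loops f \<alpha> \<beta> x B t =
     ereal_of_enat (\<Sum>i<t. loops f \<alpha> \<beta> (x i) (direction f (x i) (B i))) / ereal (real t)"

end

theory Submission
  imports Defs
begin

text \<open>
  The cost of one line search is governed by two quantities. Along the descent direction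
  \<open>d\<close> at \<open>x\<close>, write \<open>SD\<close> and \<open>CC\<close> for the sufficient decrease and the curvature condition. By
  convexity \<open>SD\<close> holds up to some step and \<open>CC\<close> holds from some smaller step on, so every trial
  that fails lies on a known side of the acceptable interval. As long as all failures are of one
  kind the exponent of the trial step doubles, so this phase ends after about \<open>log 2 log 2\<close> of the
  (inverse) scale of an acceptable step; afterwards each loop halves \<open>log 2\<close> of the ratio of the
  bracket ends, which can never fall below the \<open>log 2\<close> of the ratio of the ends of the acceptable
  interval. Hessians at two points of the sublevel set of \<open>x\<close> differ by a factor of at most
  \<open>1 + 2C\<close>, where \<open>C\<close> is the deviation \<open>M / \<mu> powr (3/2) * sqrt (2 (f x - f xstar))\<close>, and this
  bounds the ratio of the ends of the acceptable interval from below (\<open>not_SD_over_not_CC\<close>). The Hessian at \<open>xstar\<close> differs from those by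
  \<open>1 + C\<close>, so that the scale of acceptable steps is \<open>\<rho> = - (grad f x \<bullet> d) / (d \<bullet> (H d))\<close> with
  \<open>H\<close> the Hessian at \<open>xstar\<close>, up to that factor (\<open>not_SD_lower\<close>, \<open>not_CC_upper\<close>). The result is
  \<open>loops_bound\<close>, a bound in terms of \<open>C\<close> and of \<open>\<rho> - 1 - ln \<rho>\<close>.

  It remains to average over the iterations. Both \<open>C\<close> and \<open>\<rho> - 1 - ln \<rho>\<close> have bounded sums because
  \<open>\<Psi>\<close>, which is nonnegative, changes in a controlled way: \<open>\<Psi>\<close> of the update is an explicit
  expression in \<open>s\<close>, \<open>y\<close> and \<open>B s\<close> (\<open>\<Psi>_bfgs_update\<close>), also after a congruence with a fixed matrix.
  With the weight \<open>1 / L\<close>, the potential bounds how often a step can make little progress, whence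
  \<open>f (x k) - f xstar\<close> decays linearly after an initial stretch of length \<open>\<Psi>\<close> (\<open>gap_le_exp\<close>), and the
  deviations sum up to at most \<open>\<sigma>\<close> (\<open>sum_deviation_le\<close>). With the weight \<open>inv_sqrt H\<close>, each step
  lowers the potential by \<open>\<rho> - 1 - ln \<rho>\<close> up to an error of \<open>2C\<close> (\<open>\<Psi>_Btilde_Suc\<close>). Concavity of the
  logarithm then moves the averages inside the logarithms (\<open>mean_log2_le_log2_mean\<close>).
\<close>

section \<open>Elementary real inequalities\<close>

lemma mean_pos:
  fixes z :: "nat \<Rightarrow> real"
  assumes "t \<ge> 1" "\<And>i. z i > 0"
  shows "0 < (\<Sum>i<t. z i) / real t"
  using assms by (intro divide_pos_pos sum_pos2[of _ 0]) (auto simp: less_imp_le)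

text \<open>
  Jensen's inequality, from the tangent of the logarithm at the mean.
\<close>
lemma mean_log2_le_log2_mean:
  fixes z :: "nat \<Rightarrow> real"
  assumes t: "t \<ge> 1" and z: "\<And>i. z i > 0"
  shows "(\<Sum>i<t. log 2 (z i)) / real t \<le> log 2 ((\<Sum>i<t. z i) / real t)"
proof -
  define m where "m = (\<Sum>i<t. z i) / real t"
  have m: "m > 0"
    unfolding m_def using t z by (rule mean_pos)
  have "log 2 (z i) \<le> log 2 m + (z i / m - 1) / ln 2" for i
  proof -
    have "ln (z i / m) \<le> z i / m - 1" using z m by (intro ln_le_minus_one) auto
    then have "(ln (z i) - ln m) / ln 2 \<le> (z i / m - 1) / ln 2"
      using z[of i] m by (intro divide_right_mono) (auto simp: ln_div)
    then show ?thesis by (simp add: log_def diff_divide_distrib)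
  qed
  then have "(\<Sum>i<t. log 2 (z i)) \<le> (\<Sum>i<t. log 2 m + (z i / m - 1) / ln 2)"
    by (intro sum_mono)
  also have "\<dots> = real t * log 2 m + ((\<Sum>i<t. z i) / m - real t) / ln 2"
    by (simp add: sum.distrib sum_subtractf flip: sum_divide_distrib)
  also have "(\<Sum>i<t. z i) / m - real t = 0"
  proof -
    have "(\<Sum>i<t. z i) = m * real t" using t by (simp add: m_def)
    then show ?thesis using m by simp
  qed
  finally show ?thesis using t by (simp add: m_def[symmetric] field_simps)
qed

text \<open>
  The first \<open>\<lceil>P\<rceil>\<close> terms contribute at most \<open>1\<close> each and the others are dominated by a geometric series
  with ratio \<open>exp (- b)\<close>.
\<close>
lemma sum_capped_exponential_le:
  fixes c :: "nat \<Rightarrow> real"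
  assumes b: "b > 0" and P: "P \<ge> 0"
    and c: "\<And>i. c i \<le> 1" "\<And>i. c i \<le> exp (- b * (real i - P))"
  shows "(\<Sum>i<t. c i) \<le> P + 2 + 1 / b"
proof -
  define N where "N = nat \<lceil>P\<rceil>"
  have N: "P \<le> real N" "real N \<le> P + 1"
    using P by (auto simp: N_def)
  define q where "q = exp (- b)"
  have q: "0 < q" "q < 1" using b by (auto simp: q_def)
  have "c i \<le> (if i < N then 1 else 0) + (if i < N then 0 else q ^ (i - N))" for i
  proof (cases "i < N")
    case False
    have "c i \<le> exp (- b * (real i - P))" by (rule c(2))
    also have "\<dots> \<le> exp (- b * (real i - real N))" using b N by simp
    also have "\<dots> = q ^ (i - N)"
      using False by (simp add: q_def of_nat_diff mult.commute flip: exp_of_nat_mult)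
    finally show ?thesis using False by simp
  qed (use c(1) in simp)
  then have "(\<Sum>i<t. c i) \<le> (\<Sum>i<t. (if i < N then 1 else 0) + (if i < N then 0 else q ^ (i - N)))"
    by (intro sum_mono)
  also have "\<dots> = (\<Sum>i<t. if i < N then 1 else 0) + (\<Sum>i<t. if i < N then 0 else q ^ (i - N))"
    by (rule sum.distrib)
  also have "(\<Sum>i<t. if i < N then 1 else (0::real)) \<le> real N"
  proof -
    have "(\<Sum>i<t. if i < N then 1 else (0::real)) = real (card {i. i < t \<and> i < N})"
      by (simp add: sum.If_cases lessThan_def Collect_conj_eq)
    also have "\<dots> \<le> real (card {..<N})" by (intro of_nat_mono card_mono) auto
    finally show ?thesis by simp
  qed
  also have "(\<Sum>i<t. if i < N then 0 else q ^ (i - N)) \<le> 1 / (1 - q)"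
  proof -
    have "(\<Sum>i<t. if i < N then 0 else q ^ (i - N)) \<le> (\<Sum>i<N + t. if i < N then 0 else q ^ (i - N))"
      using q by (intro sum_mono2) auto
    also have "\<dots> = (\<Sum>i\<in>{N..<N + t}. q ^ (i - N))"
      by (intro sum.mono_neutral_cong_right) auto
    also have "\<dots> = (\<Sum>j<t. q ^ j)"
      by (rule sum.reindex_bij_witness[of _ "\<lambda>j. j + N" "\<lambda>i. i - N"]) auto
    also have "\<dots> = (1 - q ^ t) / (1 - q)" using q by (subst sum_gp_strict) auto
    also have "\<dots> \<le> 1 / (1 - q)" using q by (intro divide_right_mono) auto
    finally show ?thesis .
  qed
  also have "1 / (1 - q) \<le> 1 + 1 / b"
  proof -
    have "(1 + b) * q \<le> exp b * q" using q exp_ge_add_one_self[of b] by (intro mult_right_mono) auto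
    also have "\<dots> = 1" by (simp add: q_def flip: exp_add)
    finally show ?thesis using q b by (simp add: field_simps)
  qed
  finally show ?thesis using N by simp
qed

lemma one_div_one_plus_inverse_le_log2:
  fixes r :: real
  assumes "r > 0"
  shows "1 / (1 + 1 / r) \<le> log 2 (1 + r)"
proof -
  have "ln (1 / (1 + r)) \<le> 1 / (1 + r) - 1"
    using assms by (intro ln_le_minus_one) auto
  then have "r / (1 + r) \<le> ln (1 + r)"
    using assms by (simp add: ln_div field_simps)
  also have "\<dots> \<le> ln (1 + r) / ln 2"
    using assms ln_2_less_1 by (simp add: field_simps mult_left_le)
  finally show ?thesis using assms by (simp add: log_def field_simps)
qed

lemma ln_2_ge_three_fifths: "3 / 5 \<le> ln (2::real)"
  using ln2_ge_two_thirds by linarith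

text \<open>
  This lemma and the next two only serve to fit the constants of the final bound. The gap
  \<open>\<rho> - 1 - ln \<rho>\<close> is quadratic near \<open>\<rho> = 1\<close>, so it dominates \<open>\<bar>log 2 \<rho>\<bar>\<close> only together with an additive
  constant. The factor \<open>3 / 2\<close> comes from \<open>log2_scale_bound_witness\<close>. The tangents of the logarithm at
  \<open>1 / 2\<close> here and at \<open>3 / 2\<close> in the next lemma keep the additive constants small enough for
  \<open>trial_exponent_le_scale_bound\<close>.
\<close>
lemma one_minus_log2_le_convex_gap:
  fixes \<rho> :: real
  assumes "\<rho> > 0"
  shows "3 / 2 * (1 - log 2 \<rho>) \<le> 3 + 5 * (\<rho> - 1 - ln \<rho>)"
proof (cases "\<rho> \<ge> 1")
  case True
  then have "0 \<le> log 2 \<rho>" and "ln \<rho> \<le> \<rho> - 1" by (auto intro: ln_le_minus_one)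
  then show ?thesis by simp
next
  case False
  have "ln (2 * \<rho>) \<le> 2 * \<rho> - 1" using assms by (intro ln_le_minus_one) auto
  then have 1: "ln \<rho> \<le> 2 * \<rho> - 1 - ln 2" using assms by (simp add: ln_mult)
  have "- ln \<rho> \<ge> 0" using assms False by (simp add: ln_le_zero_iff)
  then have "- ln \<rho> * (3 / 5) \<le> - ln \<rho> * ln 2"
    using ln_2_ge_three_fifths by (intro mult_left_mono)
  then have "- log 2 \<rho> \<le> 5 / 3 * (- ln \<rho>)"
    by (simp add: log_def field_simps)
  then show ?thesis using 1 ln_2_ge_three_fifths by simp
qed

lemma log2_le_convex_gap:
  fixes \<rho> :: real
  assumes "\<rho> > 0"
  shows "3 / 2 * log 2 \<rho> \<le> 2 + 5 * (\<rho> - 1 - ln \<rho>)"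
proof (cases "\<rho> \<ge> 1")
  case True
  have "ln (\<rho> * (2 / 3)) \<le> \<rho> * (2 / 3) - 1" using assms by (intro ln_le_minus_one) auto
  moreover have "ln (\<rho> * (2 / 3)) = ln \<rho> - ln (3 / 2)"
    using assms by (simp add: ln_div ln_mult)
  moreover have "ln (3 / 2 :: real) \<le> 3 / 2 - 1" by (intro ln_le_minus_one) auto
  ultimately have 1: "ln \<rho> \<le> \<rho> * (2 / 3) - 1 / 2" by simp
  have "ln \<rho> * (3 / 5) \<le> ln \<rho> * ln 2"
    using ln_2_ge_three_fifths True by (intro mult_left_mono) auto
  then have "log 2 \<rho> \<le> 5 / 3 * ln \<rho>"
    by (simp add: log_def field_simps)
  then show ?thesis using 1 by simp
next
  case False
  then have "log 2 \<rho> \<le> 0" using assms by simp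
  moreover have "ln \<rho> \<le> \<rho> - 1" using assms by (intro ln_le_minus_one)
  ultimately show ?thesis by simp
qed

lemma log2_one_plus_le:
  fixes C :: real
  assumes "C \<ge> 0"
  shows "3 / 2 * log 2 (1 + C) \<le> log 2 (1 + C) + C"
proof -
  have "ln (1 + C) * (1 / 2) \<le> C * ln 2"
    using assms ln_add_one_self_le_self[OF assms] ln_2_ge_three_fifths by (intro mult_mono') (auto simp: add.commute)
  then show ?thesis by (simp add: log_def field_simps)
qed

text \<open>
  Turns bounds on increments into bounds on derivatives: the tangent inequality of a strongly convex
  function, the bounds \<open>\<mu>\<close> and \<open>L\<close> on its Hessian and the vanishing of its gradient at the minimizer
  are all obtained in this way. Only the first of them needs the quadratic error term.
\<close>
lemma real_derivative_ge_slope: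
  fixes \<phi> :: "real \<Rightarrow> real"
  assumes "(\<phi> has_real_derivative D) (at 0)" and "\<And>\<tau>. 0 < \<tau> \<Longrightarrow> \<tau> < 1 \<Longrightarrow> c * \<tau> - k * \<tau>\<^sup>2 \<le> \<phi> \<tau> - \<phi> 0"
  shows "c \<le> D"
proof -
  have "((\<lambda>\<tau>. (\<phi> \<tau> - \<phi> 0) / (\<tau> - 0)) \<longlongrightarrow> D) (at_right 0)"
    using assms(1) unfolding has_field_derivative_iff by (rule filterlim_mono) (auto simp: at_le)
  moreover have "((\<lambda>\<tau>. c - k * \<tau>) \<longlongrightarrow> c - k * 0) (at_right 0)"
    by (intro tendsto_intros)
  moreover have "\<forall>\<^sub>F \<tau> in at_right (0::real). c - k * \<tau> \<le> (\<phi> \<tau> - \<phi> 0) / (\<tau> - 0)"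
    using assms(2)
    by (auto simp: eventually_at_right[of 0 1] field_simps power2_eq_square intro!: exI[of _ 1])
  ultimately have "c - k * 0 \<le> D"
    by (intro tendsto_le[of "at_right 0" "\<lambda>\<tau>. (\<phi> \<tau> - \<phi> 0) / (\<tau> - 0)" D "\<lambda>\<tau>. c - k * \<tau>"]) auto
  then show ?thesis by simp
qed

section \<open>Symmetric matrices\<close>

lemma symmetric_dot:
  fixes A :: "real^'n^'n"
  assumes "transpose A = A"
  shows "x \<bullet> (A *v y) = (A *v x) \<bullet> y"
  by (metis assms dot_lmul_matrix transpose_matrix_vector)

text \<open>
  The quadratic \<open>t \<mapsto> (u + t v) \<bullet> A (u + t v)\<close> is nonnegative, hence has nonpositive discriminant. The
  version on a subspace is needed for the spectral theorem.
\<close>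
lemma psd_form_cauchy_schwarz:
  fixes A :: "real^'n^'n"
  assumes sym: "transpose A = A" and W: "subspace W"
    and psd: "\<And>w. w \<in> W \<Longrightarrow> 0 \<le> w \<bullet> (A *v w)"
    and u: "u \<in> W" and v: "v \<in> W"
  shows "(u \<bullet> (A *v v))\<^sup>2 \<le> (u \<bullet> (A *v u)) * (v \<bullet> (A *v v))"
proof -
  define a b c where "a = u \<bullet> (A *v u)" and "b = u \<bullet> (A *v v)" and "c = v \<bullet> (A *v v)"
  have q: "0 \<le> a + 2 * t * b + t\<^sup>2 * c" for t
  proof -
    have "u + t *\<^sub>R v \<in> W"
      using W u v by (simp add: subspace_add subspace_scale)
    from psd[OF this] have "0 \<le> (u + t *\<^sub>R v) \<bullet> (A *v (u + t *\<^sub>R v))" .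
    also have "\<dots> = a + 2 * t * b + t\<^sup>2 * c"
      using symmetric_dot[OF sym, of v u]
      by (simp add: a_def b_def c_def algebra_simps inner_commute power2_eq_square)
    finally show ?thesis .
  qed
  have "0 \<le> c" using psd[OF v] by (simp add: c_def)
  have "b\<^sup>2 \<le> a * c"
  proof (cases "c = 0")
    case True
    have "b = 0"
    proof (rule ccontr)
      assume "b \<noteq> 0"
      \<comment> \<open>at this \<open>t\<close> the affine function \<open>a + 2 t b\<close> takes the value \<open>-1\<close>\<close>
      with q[of "- (a + 1) / (2 * b)"] True show False by (simp add: field_simps)
    qed
    with True show ?thesis by simp
  next
    case False
    with \<open>0 \<le> c\<close> have "c > 0" by simp
    with q[of "- b / c"] show ?thesis
      by (simp add: field_simps power2_eq_square)
  qed
  then show ?thesis by (simp add: a_def b_def c_def)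
qed

text \<open>
  A maximizer \<open>v\<close> of the Rayleigh quotient on the unit sphere of \<open>W\<close> is an eigenvector: with \<open>l\<close> the
  maximum, \<open>l I - A\<close> is positive semidefinite on \<open>W\<close> and its form vanishes at \<open>v\<close>, so by the
  Cauchy-Schwarz inequality it maps \<open>v\<close> to a vector that is orthogonal to \<open>W\<close>.
\<close>
lemma symmetric_matrix_eigenvector_in_subspace:
  fixes A :: "real^'n^'n"
  assumes sym: "transpose A = A" and W: "subspace W" and "W \<noteq> {0}"
    and inv: "\<And>w. w \<in> W \<Longrightarrow> A *v w \<in> W"
  obtains v l where "v \<in> W" "norm v = 1" "A *v v = l *\<^sub>R v"
proof -
  define K where "K = W \<inter> sphere 0 1"
  obtain w where w: "w \<in> W" "w \<noteq> 0"
    using \<open>W \<noteq> {0}\<close> subspace_0[OF W] by auto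
  then have "w /\<^sub>R norm w \<in> K"
    using W by (simp add: K_def subspace_scale)
  then have "K \<noteq> {}" by auto
  have "compact K"
    unfolding K_def using W by (intro closed_Int_compact closed_subspace) auto
  have "continuous_on K (\<lambda>x. x \<bullet> (A *v x))"
    by (intro continuous_intros linear_continuous_on linear_conv_bounded_linear[THEN iffD1]) auto
  with \<open>compact K\<close> \<open>K \<noteq> {}\<close> obtain v where v: "v \<in> K" and
    max: "\<And>x. x \<in> K \<Longrightarrow> x \<bullet> (A *v x) \<le> v \<bullet> (A *v v)"
    by (meson continuous_attains_sup)
  have vW: "v \<in> W" and nv: "norm v = 1" using v by (auto simp: K_def)
  define l where "l = v \<bullet> (A *v v)"
  define N where "N = l *\<^sub>R mat 1 - A"
  have N: "N *v x = l *\<^sub>R x - A *v x" for x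
    by (simp add: N_def matrix_vector_mult_diff_rdistrib flip: scaleR_matrix_vector_assoc)
  have symN: "transpose N = N"
    using sym by (auto simp: N_def transpose_def vec_eq_iff mat_def)
  have psd: "0 \<le> w \<bullet> (N *v w)" if "w \<in> W" for w
  proof (cases "w = 0")
    case False
    define z where "z = w /\<^sub>R norm w"
    have "z \<in> K" using that W False by (simp add: K_def z_def subspace_scale)
    then have "z \<bullet> (A *v z) \<le> l" using max by (simp add: l_def)
    moreover have "w = norm w *\<^sub>R z" using False by (simp add: z_def)
    then have "w \<bullet> (A *v w) = (norm w)\<^sup>2 * (z \<bullet> (A *v z))"
      by (metis (no_types, lifting) inner_scaleR_left inner_scaleR_right matrix_vector_mult_scaleR mult.assoc power2_eq_square)
    ultimately have "w \<bullet> (A *v w) \<le> (norm w)\<^sup>2 * l"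
      by (simp add: mult_left_mono)
    then show ?thesis
      by (simp add: N algebra_simps power2_norm_eq_inner)
  qed simp
  have "v \<bullet> (N *v v) = 0"
    using nv by (simp add: N l_def inner_diff_right flip: power2_norm_eq_inner)
  have Nv: "N *v v \<in> W"
    using W vW inv by (simp add: N subspace_diff subspace_scale)
  have "((N *v v) \<bullet> (N *v v))\<^sup>2 \<le> ((N *v v) \<bullet> (N *v (N *v v))) * (v \<bullet> (N *v v))"
    by (rule psd_form_cauchy_schwarz[OF symN W psd Nv vW])
  then have "N *v v = 0" using \<open>v \<bullet> (N *v v) = 0\<close> by simp
  then have "A *v v = l *\<^sub>R v" by (simp add: N)
  with vW nv that show thesis by blast
qed

text \<open>
  Induction on the dimension: the orthogonal complement in \<open>W\<close> of an eigenvector is again invariant.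
\<close>
lemma symmetric_matrix_orthonormal_eigenvectors:
  fixes A :: "real^'n^'n"
  assumes sym: "transpose A = A"
  shows "subspace W \<Longrightarrow> (\<And>w. w \<in> W \<Longrightarrow> A *v w \<in> W) \<Longrightarrow>
    \<exists>E. pairwise orthogonal E \<and> (\<forall>e\<in>E. norm e = 1 \<and> (\<exists>l. A *v e = l *\<^sub>R e)) \<and> E \<subseteq> W \<and> W \<subseteq> span E"
proof (induction "dim W" arbitrary: W rule: less_induct)
  case less
  show ?case
  proof (cases "W = {0}")
    case True
    then show ?thesis by (intro exI[of _ "{}"]) auto
  next
    case False
    obtain v l where v: "v \<in> W" "norm v = 1" "A *v v = l *\<^sub>R v"
      using symmetric_matrix_eigenvector_in_subspace[OF sym less.prems(1) False less.prems(2)] by blast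
    have vv: "v \<bullet> v = 1" using v(2) by (simp add: norm_eq_1)
    define W' where "W' = W \<inter> {w. v \<bullet> w = 0}"
    have sub: "subspace W'"
      unfolding W'_def using less.prems(1) by (simp add: subspace_inter subspace_hyperplane)
    have "v \<notin> W'" using vv by (simp add: W'_def)
    have "W' \<subset> W" using \<open>v \<notin> W'\<close> v(1) unfolding W'_def by blast
    then have "dim W' < dim W"
      using sub less.prems(1) by (intro dim_psubset) (simp add: span_eq_iff[THEN iffD2])
    moreover have "A *v w \<in> W'" if "w \<in> W'" for w
      using that less.prems(2) symmetric_dot[OF sym, of v w] v(3) by (auto simp: W'_def)
    ultimately obtain E where E: "pairwise orthogonal E"
      "\<forall>e\<in>E. norm e = 1 \<and> (\<exists>l. A *v e = l *\<^sub>R e)" "E \<subseteq> W'" "W' \<subseteq> span E"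
      using less.hyps sub by meson
    have "pairwise orthogonal (insert v E)"
      using E(1,3) by (auto simp: pairwise_insert orthogonal_def W'_def inner_commute)
    moreover have "W \<subseteq> span (insert v E)"
    proof
      fix w assume "w \<in> W"
      define w' where "w' = w - (v \<bullet> w) *\<^sub>R v"
      have "w' \<in> W'"
        using \<open>w \<in> W\<close> v(1) less.prems(1) vv
        by (simp add: w'_def W'_def subspace_diff subspace_scale inner_diff_right)
      then have "w' \<in> span (insert v E)"
        using E(4) span_mono[of E "insert v E"] by blast
      moreover have "w = w' + (v \<bullet> w) *\<^sub>R v" by (simp add: w'_def)
      ultimately show "w \<in> span (insert v E)"
        by (metis insertI1 span_add span_base span_scale)
    qed
    ultimately show ?thesis
      using E v \<open>W' \<subset> W\<close> by (intro exI[of _ "insert v E"]) auto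
  qed
qed

definition diagonal :: "('n \<Rightarrow> real) \<Rightarrow> real^'n^'n" where
  "diagonal l = (\<chi> i j. if i = j then l i else 0)"


lemma transpose_diagonal: "transpose (diagonal l) = diagonal l"
  by (auto simp: diagonal_def transpose_def vec_eq_iff)

lemma det_diagonal_prod: "det (diagonal l) = (\<Prod>i\<in>UNIV. l i)"
  by (subst det_diagonal) (auto simp: diagonal_def)

lemma trace_diagonal: "trace (diagonal l) = (\<Sum>i\<in>UNIV. l i)"
  by (simp add: trace_def diagonal_def)

lemma diagonal_vec: "diagonal l *v v = (\<chi> i. l i * v $ i)"
proof -
  have "(\<Sum>j\<in>UNIV. (if i = j then l i else 0) * v $ j) = (\<Sum>j\<in>UNIV. if j = i then l i * v $ i else 0)" for i
    by (intro sum.cong) auto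
  then show ?thesis by (simp add: diagonal_def matrix_vector_mult_def vec_eq_iff)
qed

lemma diagonal_mult: "diagonal l ** diagonal m = diagonal (\<lambda>i. l i * m i)"
  by (simp add: matrix_eq diagonal_vec vec_eq_iff flip: matrix_vector_mul_assoc)

theorem symmetric_matrix_spectral:
  fixes A :: "real^'n^'n"
  assumes sym: "transpose A = A"
  obtains Q l where "orthogonal_matrix Q" "A = Q ** diagonal l ** transpose Q"
proof -
  obtain E where E: "pairwise orthogonal E" "\<forall>e\<in>E. norm e = 1 \<and> (\<exists>l. A *v e = l *\<^sub>R e)"
    "UNIV \<subseteq> span E"
    using symmetric_matrix_orthonormal_eigenvectors[OF sym, of UNIV] by auto
  have ind: "independent E"
    using E(1,2) by (intro pairwise_orthogonal_independent) auto
  then have "card E = CARD('n)"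
    using E(3) dim_eq_card[of E "UNIV::(real^'n) set"] by (simp add: top.extremum_unique)
  then obtain q where q: "bij_betw q (UNIV::'n set) E"
    by (metis finite_class.finite_UNIV finite_same_card_bij finiteI_independent ind)
  have qE: "q i \<in> E" for i using q by (auto simp: bij_betw_def)
  have qo: "orthogonal (q i) (q j)" if "i \<noteq> j" for i j
    using that E(1) q qE unfolding pairwise_def bij_betw_def inj_on_def by blast
  have "\<forall>i. \<exists>l. A *v q i = l *\<^sub>R q i" using E(2) qE by blast
  then obtain l where l: "\<And>i. A *v q i = l i *\<^sub>R q i" by metis
  define Q :: "real^'n^'n" where "Q = (\<chi> i j. q j $ i)"
  have col: "column j Q = q j" for j by (simp add: Q_def column_def)
  have Q: "orthogonal_matrix Q"
    using E(2) qE qo by (simp add: orthogonal_matrix_orthonormal_columns col)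
  have "A ** Q = Q ** diagonal l"
  proof -
    have "(A ** Q) $ i $ j = (Q ** diagonal l) $ i $ j" for i j
    proof -
      have "(A ** Q) $ i $ j = (A *v q j) $ i"
        by (simp add: matrix_matrix_mult_def matrix_vector_mult_def Q_def)
      also have "\<dots> = (Q ** diagonal l) $ i $ j"
        by (simp add: l matrix_matrix_mult_def diagonal_def Q_def if_distrib cong: if_cong)
      finally show ?thesis .
    qed
    then show ?thesis by (simp add: vec_eq_iff)
  qed
  then have "A = Q ** diagonal l ** transpose Q"
    by (metis Q matrix_mul_assoc matrix_mul_rid orthogonal_matrix_def)
  with Q that show thesis by blast
qed

lemma spd_spectral:
  fixes A :: "real^'n^'n"
  assumes "spd A"
  obtains Q l where "orthogonal_matrix Q" "\<And>i. l i > 0" "A = Q ** diagonal l ** transpose Q"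
proof -
  obtain Q l where Q: "orthogonal_matrix Q" and A: "A = Q ** diagonal l ** transpose Q"
    using assms symmetric_matrix_spectral[of A] by (auto simp: spd_def)
  have QQ: "transpose Q ** Q = mat 1" using Q by (simp add: orthogonal_matrix)
  have "l i > 0" for i
  proof -
    define v where "v = Q *v axis i 1"
    have tv: "transpose Q *v v = axis i 1"
      using QQ by (metis v_def matrix_vector_mul_assoc matrix_vector_mul_lid)
    then have "v \<noteq> 0" by (metis axis_eq_0_iff matrix_vector_mult_0_right zero_neq_one)
    then have "0 < v \<bullet> (A *v v)" using assms by (simp add: spd_def)
    also have "v \<bullet> (A *v v) = v \<bullet> (Q *v (diagonal l *v (transpose Q *v v)))"
      by (simp only: A matrix_vector_mul_assoc matrix_mul_assoc)
    also have "\<dots> = (transpose Q *v v) \<bullet> (diagonal l *v (transpose Q *v v))"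
      by (simp add: dot_lmul_matrix)
    also have "\<dots> = l i"
      unfolding tv by (simp add: diagonal_vec inner_axis')
    finally show ?thesis .
  qed
  with Q A that show thesis by blast
qed

lemma det_conj_orthogonal:
  assumes "orthogonal_matrix (Q::real^'n^'n)"
  shows "det (Q ** D ** transpose Q) = det D"
proof -
  have "det Q * det (transpose Q) = 1"
    by (metis assms det_I det_mul orthogonal_matrix_def)
  then show ?thesis by (simp add: det_mul mult.commute)
qed

lemma trace_conj_orthogonal:
  assumes "orthogonal_matrix (Q::real^'n^'n)"
  shows "trace (Q ** D ** transpose Q) = trace D"
proof -
  have "trace (Q ** D ** transpose Q) = trace (transpose Q ** (Q ** D))"
    by (rule trace_mul_sym)
  also have "transpose Q ** (Q ** D) = D"
    using assms by (simp add: matrix_mul_assoc orthogonal_matrix)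
  finally show ?thesis .
qed

lemma spd_det_pos:
  assumes "spd A"
  shows "det A > 0"
proof -
  obtain Q l where "orthogonal_matrix Q" "\<And>i. l i > 0" "A = Q ** diagonal l ** transpose Q"
    using spd_spectral[OF assms] by blast
  then show ?thesis by (simp add: det_conj_orthogonal det_diagonal_prod prod_pos)
qed

text \<open>
  In terms of the eigenvalues \<open>\<Psi>\<close> is the sum of \<open>l - 1 - ln l\<close>.
\<close>
lemma \<Psi>_nonneg:
  fixes A :: "real^'n^'n"
  assumes "spd A"
  shows "0 \<le> \<Psi> A"
proof -
  obtain Q l where Q: "orthogonal_matrix Q" and l: "\<And>i. l i > 0"
    and A: "A = Q ** diagonal l ** transpose Q"
    using spd_spectral[OF assms] by blast
  have "ln (det A) = (\<Sum>i\<in>UNIV. ln (l i))"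
    using l by (simp add: A det_conj_orthogonal[OF Q] det_diagonal_prod ln_prod less_imp_neq[symmetric])
  moreover have "trace A = (\<Sum>i\<in>UNIV. l i)"
    by (simp add: A trace_conj_orthogonal[OF Q] trace_diagonal)
  moreover have "(\<Sum>i\<in>UNIV. ln (l i)) \<le> (\<Sum>i\<in>UNIV. l i - 1)"
    using l by (intro sum_mono ln_le_minus_one)
  ultimately show ?thesis
    by (simp add: \<Psi>_def sum_subtractf)
qed

lemma spd_invertible: "spd A \<Longrightarrow> invertible A"
  by (metis invertible_det_nz less_irrefl spd_det_pos)

lemma matrix_inv_inverse:
  assumes "invertible A"
  shows "A ** matrix_inv A = mat 1" "matrix_inv A ** A = mat 1"
  using someI_ex[OF assms[unfolded invertible_def]] by (auto simp: matrix_inv_def)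

lemma matrix_inv_vec:
  assumes "invertible (A::real^'n^'n)"
  shows "A *v (matrix_inv A *v v) = v" "matrix_inv A *v (A *v v) = v"
  using matrix_inv_inverse[OF assms] by (simp_all add: matrix_vector_mul_assoc)

lemma spd_matrix_inv:
  fixes A :: "real^'n^'n"
  assumes "spd A"
  shows "spd (matrix_inv A)"
proof -
  note inv = spd_invertible[OF assms]
  have sym: "transpose A = A" using assms by (simp add: spd_def)
  have "transpose (matrix_inv A) ** A = mat 1"
    by (metis inv matrix_inv_inverse(1) matrix_transpose_mul sym transpose_mat)
  then have "transpose (matrix_inv A) = matrix_inv A"
    by (metis inv matrix_inv_inverse(1) matrix_mul_assoc matrix_mul_lid matrix_mul_rid)
  moreover have "v \<bullet> (matrix_inv A *v v) > 0" if "v \<noteq> 0" for v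
  proof -
    define w where "w = matrix_inv A *v v"
    have v: "A *v w = v" by (simp add: w_def matrix_inv_vec[OF inv])
    with that have "w \<noteq> 0" by auto
    then have "0 < w \<bullet> (A *v w)" using assms by (simp add: spd_def)
    then show ?thesis by (simp add: v w_def[symmetric] inner_commute)
  qed
  ultimately show ?thesis by (simp add: spd_def)
qed

lemma spd_add: "spd A \<Longrightarrow> spd B \<Longrightarrow> spd (A + B)"
  by (auto simp: spd_def transpose_def vec_eq_iff matrix_vector_mult_add_rdistrib inner_add_right add_pos_pos)

lemma trace_congruence_columns:
  fixes P D :: "real^'n^'n"
  shows "trace (transpose D ** P ** D) = (\<Sum>j\<in>UNIV. column j D \<bullet> (P *v column j D))"
proof -
  have "(transpose D ** (P ** D)) $ j $ j = column j D \<bullet> (P *v column j D)" for j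
    by (simp add: matrix_matrix_mult_def transpose_def column_def inner_vec_def matrix_vector_mult_def)
  then show ?thesis by (simp add: trace_def flip: matrix_mul_assoc)
qed

text \<open>
  With \<open>D = S - T\<close> and \<open>P = S + T\<close>, the assumption says that \<open>P D + D P = 0\<close>. Multiplying by \<open>D\<close> and taking
  traces gives \<open>2 trace (D P D) = 0\<close>, and this trace is the sum of the values of the form of \<open>P\<close> on
  the columns of \<open>D\<close>.
\<close>
lemma spd_sqrt_unique:
  fixes S T :: "real^'n^'n"
  assumes "spd S" "spd T" "S ** S = T ** T"
  shows "S = T"
proof -
  define D P where "D = S - T" and "P = S + T"
  have P: "spd P" using assms by (simp add: P_def spd_add)
  have tD: "transpose D = D"
    using assms by (simp add: D_def spd_def transpose_def vec_eq_iff)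
  have "P ** D + D ** P = 0"
    using assms(3) unfolding matrix_eq P_def D_def
    by (simp add: algebra_simps flip: matrix_vector_mul_assoc)
  then have "trace (D ** (P ** D + D ** P)) = 0" by (simp add: trace_def)
  moreover have "trace (D ** (P ** D + D ** P)) = 2 * trace (D ** P ** D)"
    by (simp add: matrix_add_ldistrib trace_add matrix_mul_assoc)
      (metis matrix_mul_assoc trace_mul_sym)
  ultimately have "(\<Sum>j\<in>UNIV. column j D \<bullet> (P *v column j D)) = 0"
    using trace_congruence_columns[of D P] tD by simp
  moreover have nn: "0 \<le> column j D \<bullet> (P *v column j D)" for j
    using P by (cases "column j D = 0") (auto simp: spd_def less_imp_le)
  ultimately have "\<forall>j. column j D \<bullet> (P *v column j D) = 0"
    by (subst (asm) sum_nonneg_eq_0_iff) auto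
  then have "column j D = 0" for j
    using P unfolding spd_def by (metis less_irrefl)
  then have "D = 0" by (simp add: vec_eq_iff column_def)
  then show ?thesis by (simp add: D_def)
qed

lemma spd_conj_orthogonal_diagonal:
  fixes Q :: "real^'n^'n"
  assumes Q: "orthogonal_matrix Q" and l: "\<And>i. l i > 0"
  shows "spd (Q ** diagonal l ** transpose Q)"
proof -
  have "v \<bullet> (Q ** diagonal l ** transpose Q *v v) > 0" if "v \<noteq> 0" for v
  proof -
    define w where "w = transpose Q *v v"
    have "Q *v w = v" using Q
      by (metis w_def matrix_vector_mul_assoc matrix_vector_mul_lid orthogonal_matrix_def)
    with that have "w \<noteq> 0" by auto
    then obtain k where "w $ k \<noteq> 0" by (auto simp: vec_eq_iff)
    have "v \<bullet> (Q ** diagonal l ** transpose Q *v v) = v \<bullet> (Q *v (diagonal l *v w))"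
      by (simp only: w_def matrix_vector_mul_assoc matrix_mul_assoc)
    also have "\<dots> = w \<bullet> (diagonal l *v w)"
      by (simp add: w_def dot_lmul_matrix)
    also have "\<dots> = (\<Sum>i\<in>UNIV. l i * (w $ i)\<^sup>2)"
      by (simp add: diagonal_vec inner_vec_def power2_eq_square algebra_simps)
    also have "\<dots> > 0"
      using l \<open>w $ k \<noteq> 0\<close> by (intro sum_pos2[of _ k]) (auto simp: less_imp_le)
    finally show ?thesis .
  qed
  then show ?thesis
    by (simp add: spd_def matrix_transpose_mul transpose_diagonal matrix_mul_assoc)
qed

text \<open>
  Existence and uniqueness of the square root show that the definite description denotes it.
\<close>
lemma inv_sqrt_spd:
  fixes A :: "real^'n^'n"
  assumes "spd A"
  shows "spd (inv_sqrt A)" and "inv_sqrt A ** inv_sqrt A = matrix_inv A"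
proof -
  obtain Q l where Q: "orthogonal_matrix Q" and l: "\<And>i. l i > 0"
    and A: "matrix_inv A = Q ** diagonal l ** transpose Q"
    using spd_spectral[OF spd_matrix_inv[OF assms]] by blast
  define S where "S = Q ** diagonal (\<lambda>i. sqrt (l i)) ** transpose Q"
  have "spd S" unfolding S_def using Q l by (intro spd_conj_orthogonal_diagonal) auto
  have "S ** S = Q ** (diagonal (\<lambda>i. sqrt (l i)) ** (transpose Q ** Q) ** diagonal (\<lambda>i. sqrt (l i))) ** transpose Q"
    by (simp add: S_def matrix_mul_assoc)
  also have "\<dots> = matrix_inv A"
    using Q l by (simp add: orthogonal_matrix diagonal_mult A less_imp_le)
  finally have "S ** S = matrix_inv A" .
  have "spd (inv_sqrt A) \<and> inv_sqrt A ** inv_sqrt A = matrix_inv A"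
    unfolding inv_sqrt_def
    by (rule theI[of _ S]) (use \<open>spd S\<close> \<open>S ** S = matrix_inv A\<close> in \<open>auto intro: spd_sqrt_unique\<close>)
  then show "spd (inv_sqrt A)" "inv_sqrt A ** inv_sqrt A = matrix_inv A" by auto
qed

section \<open>Determinants of rank-one perturbations\<close>

lemma outer_vec: "outer u v *v w = (v \<bullet> w) *\<^sub>R u"
  by (simp add: outer_def matrix_vector_mult_def vec_eq_iff inner_vec_def sum_distrib_right
      sum_distrib_left algebra_simps)

lemma trace_outer: "trace (outer u v) = u \<bullet> v"
  by (simp add: trace_def outer_def inner_vec_def)

text \<open>
  Only row \<open>k\<close> differs from that of the identity, and its entries off the diagonal can be removed by
  adding multiples of the other rows.
\<close>
lemma det_one_plus_outer_axis:
  fixes w :: "real^'n"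
  shows "det (mat 1 + outer (c *\<^sub>R axis k 1) w) = 1 + c * w $ k"
proof -
  define A :: "real^'n^'n" where "A = diagonal (\<lambda>i. if i = k then 1 + c * w $ k else 1)"
  have row: "row j A = axis j 1" if "j \<noteq> k" for j
    using that by (simp add: A_def diagonal_def row_def axis_def vec_eq_iff)
  define x where "x = (\<Sum>j\<in>UNIV - {k}. (c * w $ j) *s row j A)"
  have "x \<in> vec.span {row j A |j. j \<noteq> k}"
    unfolding x_def by (intro vec.span_sum vec.span_scale vec.span_base) auto
  then have "det (\<chi> i. if i = k then row k A + x else row i A) = det A"
    by (rule det_row_span)
  moreover have "(\<chi> i. if i = k then row k A + x else row i A) = mat 1 + outer (c *\<^sub>R axis k 1) w"
  proof -
    have "x $ j = (if j = k then 0 else c * w $ j)" for j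
    proof -
      have "x $ j = (\<Sum>i\<in>UNIV - {k}. if i = j then c * w $ j else 0)"
        unfolding x_def sum_component by (intro sum.cong) (auto simp: row axis_def)
      then show ?thesis by simp
    qed
    then show ?thesis
      by (auto simp: vec_eq_iff row A_def diagonal_def row_def mat_def outer_def axis_def)
  qed
  moreover have "det A = 1 + c * w $ k"
    by (simp add: A_def det_diagonal_prod)
  ultimately show ?thesis by simp
qed

text \<open>
  The determinant is invariant under orthogonal conjugation, and some orthogonal matrix takes a multiple
  of a coordinate vector to \<open>u\<close>.
\<close>
lemma det_one_plus_outer:
  fixes u v :: "real^'n"
  shows "det (mat 1 + outer u v) = 1 + v \<bullet> u"
proof -
  \<comment> \<open>any coordinate will do\<close>
  fix k :: 'n
  obtain q :: "real^'n \<Rightarrow> real^'n" where q: "orthogonal_transformation q" "q (norm u *\<^sub>R axis k 1) = u"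
    by (rule orthogonal_transformation_exists[of "norm u *\<^sub>R axis k 1" u]) simp
  define Q where "Q = matrix q"
  have Q: "orthogonal_matrix Q" and "linear q"
    using q(1) by (auto simp: Q_def orthogonal_transformation_matrix)
  then have Qu: "Q *v (norm u *\<^sub>R axis k 1) = u"
    using q(2) by (simp add: Q_def matrix_works)
  have "Q ** transpose Q = mat 1" using Q by (simp add: orthogonal_matrix_def)
  then have QQ: "Q *v (z v* Q) = z" for z
    by (simp add: matrix_vector_mul_assoc flip: transpose_matrix_vector)
  define w where "w = v v* Q"
  have dot: "w \<bullet> (z v* Q) = v \<bullet> z" for z
    by (simp add: w_def dot_lmul_matrix QQ)
  have "mat 1 + outer u v = Q ** (mat 1 + outer (norm u *\<^sub>R axis k 1) w) ** transpose Q"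
    unfolding matrix_eq
    by (simp add: matrix_vector_mult_add_rdistrib matrix_vector_right_distrib outer_vec dot QQ Qu
        matrix_vector_mult_scaleR[of Q "v \<bullet> _"]
        del: scaleR_scaleR flip: matrix_vector_mul_assoc)
  then have "det (mat 1 + outer u v) = 1 + norm u * w $ k"
    by (simp only: det_conj_orthogonal[OF Q] det_one_plus_outer_axis)
  also have "norm u * w $ k = w \<bullet> (norm u *\<^sub>R axis k 1)"
    by (simp add: inner_axis)
  also have "\<dots> = v \<bullet> u"
    unfolding w_def dot_lmul_matrix Qu ..
  finally show ?thesis .
qed

lemma det_plus_outer:
  fixes B :: "real^'n^'n"
  assumes "invertible B"
  shows "det (B + outer u v) = det B * (1 + v \<bullet> (matrix_inv B *v u))"
proof -
  have "B + outer u v = B ** (mat 1 + outer (matrix_inv B *v u) v)"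
    unfolding matrix_eq
    by (simp add: algebra_simps outer_vec matrix_inv_vec[OF assms] flip: matrix_vector_mul_assoc)
  then show ?thesis by (simp add: det_mul det_one_plus_outer)
qed

lemma transpose_add: "transpose (A + B) = transpose A + transpose B"
  by (simp add: transpose_def vec_eq_iff)

lemma spd_plus_outer:
  fixes B :: "real^'n^'n"
  assumes "spd B" "c \<ge> 0"
  shows "spd (B + outer (c *\<^sub>R y) y)"
proof -
  have "v \<bullet> ((B + outer (c *\<^sub>R y) y) *v v) > 0" if "v \<noteq> 0" for v
  proof -
    have "v \<bullet> ((B + outer (c *\<^sub>R y) y) *v v) = v \<bullet> (B *v v) + c * (y \<bullet> v)\<^sup>2"
      by (simp add: matrix_vector_mult_add_rdistrib outer_vec inner_add_right power2_eq_square inner_commute)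
    then show ?thesis
      using assms that by (simp add: spd_def add_pos_nonneg)
  qed
  moreover have "transpose (outer (c *\<^sub>R y) y) = outer (c *\<^sub>R y) y"
    by (simp add: transpose_def outer_def vec_eq_iff)
  ultimately show ?thesis using assms(1) by (simp add: spd_def transpose_add)
qed

section \<open>The BFGS update and its potential\<close>

text \<open>
  The update is \<open>B\<close> with two rank-one terms, applied one after the other; in this order the
  intermediate matrix is positive definite, so that \<open>det_plus_outer\<close> applies twice.
\<close>
lemma bfgs_update_eq_outer:
  fixes B :: "real^'n^'n"
  assumes "transpose B = B"
  shows "bfgs_update B s y = B + outer ((1 / (s \<bullet> y)) *\<^sub>R y) y
           + outer ((- 1 / (s \<bullet> (B *v s))) *\<^sub>R (B *v s)) (B *v s)"
proof -
  have "B *v (outer s s *v (B *v v)) = ((B *v s) \<bullet> v) *\<^sub>R (B *v s)" for v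
    by (simp add: outer_vec matrix_vector_mult_scaleR symmetric_dot[OF assms])
  then show ?thesis
    unfolding matrix_eq bfgs_update_def
    by (simp add: matrix_vector_mult_add_rdistrib matrix_vector_mult_diff_rdistrib outer_vec
        flip: matrix_vector_mul_assoc scaleR_matrix_vector_assoc)
qed

text \<open>
  Subtracting the first rank-one term leaves the form of \<open>B\<close> at the component \<open>w\<close> of \<open>v\<close> that is
  \<open>B\<close>-orthogonal to \<open>s\<close>; when \<open>w = 0\<close>, the second rank-one term is positive because \<open>s \<bullet> y > 0\<close>.
\<close>
lemma spd_bfgs_update:
  fixes B :: "real^'n^'n"
  assumes B: "spd B" and sy: "s \<bullet> y > 0"
  shows "spd (bfgs_update B s y)"
proof -
  have sym: "transpose B = B" using B by (simp add: spd_def)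
  have "s \<noteq> 0" using sy by auto
  define b where "b = s \<bullet> (B *v s)"
  have b: "b > 0" using B \<open>s \<noteq> 0\<close> by (simp add: b_def spd_def)
  have "v \<bullet> (bfgs_update B s y *v v) > 0" if "v \<noteq> 0" for v
  proof -
    define r where "r = (s \<bullet> (B *v v)) / b"
    define w where "w = v - r *\<^sub>R s"
    have "v \<bullet> (bfgs_update B s y *v v) = v \<bullet> (B *v v) - r * (s \<bullet> (B *v v)) + (y \<bullet> v)\<^sup>2 / (s \<bullet> y)"
      using symmetric_dot[OF sym, of s v]
      by (simp add: bfgs_update_eq_outer[OF sym] matrix_vector_mult_add_rdistrib outer_vec
          inner_add_right inner_diff_right r_def b_def[symmetric] inner_commute power2_eq_square)
    moreover have "w \<bullet> (B *v w) = v \<bullet> (B *v v) - 2 * r * (s \<bullet> (B *v v)) + r\<^sup>2 * b"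
      using symmetric_dot[OF sym, of v s]
      by (simp add: w_def b_def algebra_simps inner_commute power2_eq_square)
    moreover have "r\<^sup>2 * b = r * (s \<bullet> (B *v v))"
      using b by (simp add: r_def power2_eq_square)
    ultimately have eq: "v \<bullet> (bfgs_update B s y *v v) = w \<bullet> (B *v w) + (y \<bullet> v)\<^sup>2 / (s \<bullet> y)"
      by simp
    show ?thesis
    proof (cases "w = 0")
      case True
      then have "v = r *\<^sub>R s" by (simp add: w_def)
      with that sy have "y \<bullet> v \<noteq> 0" by (auto simp: inner_commute)
      then show ?thesis using eq True sy by simp
    next
      case False
      then show ?thesis using eq B sy by (simp add: spd_def add_pos_nonneg)
    qed
  qed
  moreover have "transpose (bfgs_update B s y) = bfgs_update B s y"
    unfolding bfgs_update_eq_outer[OF sym] transpose_add sym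
    by (simp add: transpose_def outer_def vec_eq_iff mult.commute)
  ultimately show ?thesis by (simp add: spd_def)
qed

text \<open>
  The intermediate matrix \<open>M\<close> satisfies \<open>M s = B s + y\<close>, which expresses \<open>M\<^sup>-\<^sup>1 (B s)\<close> through \<open>M\<^sup>-\<^sup>1 y\<close>. The
  latter is a multiple of \<open>B\<^sup>-\<^sup>1 y\<close>, and all occurrences of \<open>y \<bullet> B\<^sup>-\<^sup>1 y\<close> cancel.
\<close>
lemma det_bfgs_update:
  fixes B :: "real^'n^'n"
  assumes B: "spd B" and sy: "s \<bullet> y > 0"
  shows "det (bfgs_update B s y) = det B * ((s \<bullet> y) / (s \<bullet> (B *v s)))"
proof -
  have sym: "transpose B = B" using B by (simp add: spd_def)
  have "s \<noteq> 0" using sy by auto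
  define b where "b = s \<bullet> (B *v s)"
  have b: "b > 0" using B \<open>s \<noteq> 0\<close> by (simp add: b_def spd_def)
  define d where "d = s \<bullet> y"
  have d: "d > 0" using sy by (simp add: d_def)
  define M where "M = B + outer ((1 / d) *\<^sub>R y) y"
  have M: "spd M" unfolding M_def using B d by (intro spd_plus_outer) auto
  then have symM: "transpose M = M" by (simp add: spd_def)
  note invB = matrix_inv_vec[OF spd_invertible[OF B]]
  note invM = matrix_inv_vec[OF spd_invertible[OF M]]
  define a where "a = y \<bullet> (matrix_inv B *v y)"
  have a: "a \<ge> 0"
    using spd_matrix_inv[OF B] by (cases "y = 0") (auto simp: a_def spd_def less_imp_le)
  have detM: "det M = det B * (1 + a / d)"
    unfolding M_def by (subst det_plus_outer[OF spd_invertible[OF B]])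
      (simp add: a_def matrix_vector_mult_scaleR)
  have M_vec: "M *v v = B *v v + ((y \<bullet> v) / d) *\<^sub>R y" for v
    by (simp add: M_def matrix_vector_mult_add_rdistrib outer_vec)
  define w where "w = matrix_inv M *v y"
  have "M *v ((1 / (1 + a / d)) *\<^sub>R (matrix_inv B *v y)) = y"
  proof -
    have "M *v (matrix_inv B *v y) = (1 + a / d) *\<^sub>R y"
      by (simp add: M_vec invB a_def algebra_simps)
    then show ?thesis using a d by (simp add: matrix_vector_mult_scaleR add_pos_nonneg less_imp_neq[symmetric])
  qed
  then have w: "w = (1 / (1 + a / d)) *\<^sub>R (matrix_inv B *v y)"
    unfolding w_def by (metis invM(2))
  have yw: "y \<bullet> w = a / (1 + a / d)" by (simp add: w a_def)
  have "M *v s = B *v s + y" using d by (simp add: M_vec d_def inner_commute)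
  then have "matrix_inv M *v (B *v s) = s - w"
    by (metis add_diff_cancel_right' invM(2) matrix_vector_mult_diff_distrib w_def)
  moreover have "(B *v s) \<bullet> w = y \<bullet> (s - w)"
  proof -
    have "(M *v s) \<bullet> w = s \<bullet> y"
      using symmetric_dot[OF symM, of s w] invM(1) by (simp add: w_def)
    with \<open>M *v s = B *v s + y\<close> show ?thesis
      by (simp add: inner_add_left inner_add_right inner_diff_right inner_commute)
  qed
  moreover have "(B *v s) \<bullet> s = b" by (simp add: b_def inner_commute)
  ultimately have "1 + (B *v s) \<bullet> (matrix_inv M *v ((- 1 / b) *\<^sub>R (B *v s))) = (d - y \<bullet> w) / b"
    using b unfolding matrix_vector_mult_scaleR
    by (simp add: inner_diff_right d_def inner_commute[of y s] diff_divide_distrib)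
  then have "det (bfgs_update B s y) = det M * ((d - y \<bullet> w) / b)"
    unfolding bfgs_update_eq_outer[OF sym] b_def[symmetric] d_def[symmetric] M_def[symmetric]
    by (subst det_plus_outer[OF spd_invertible[OF M]]) simp
  also have "d - y \<bullet> w = d / (1 + a / d)"
    using a d by (simp add: yw field_simps add_pos_nonneg)
  also have "det M * (d / (1 + a / d) / b) = det B * (d / b)"
    using a d by (simp add: detM add_pos_nonneg less_imp_neq[symmetric])
  finally show ?thesis by (simp add: b_def d_def)
qed

lemma \<Psi>_bfgs_update:
  fixes B :: "real^'n^'n"
  assumes B: "spd B" and sy: "s \<bullet> y > 0"
  shows "\<Psi> (bfgs_update B s y) = \<Psi> B - (norm (B *v s))\<^sup>2 / (s \<bullet> (B *v s)) + (norm y)\<^sup>2 / (s \<bullet> y)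
           - ln ((s \<bullet> y) / (s \<bullet> (B *v s)))"
proof -
  have sym: "transpose B = B" using B by (simp add: spd_def)
  have "s \<noteq> 0" using sy by auto
  then have b: "s \<bullet> (B *v s) > 0" using B by (simp add: spd_def)
  have "ln (det (bfgs_update B s y)) = ln (det B) + ln ((s \<bullet> y) / (s \<bullet> (B *v s)))"
    unfolding det_bfgs_update[OF B sy] using spd_det_pos[OF B] sy b by (intro ln_mult_pos) auto
  moreover have "trace (bfgs_update B s y) = trace B + (norm y)\<^sup>2 / (s \<bullet> y) - (norm (B *v s))\<^sup>2 / (s \<bullet> (B *v s))"
    by (simp add: bfgs_update_eq_outer[OF sym] trace_add trace_outer power2_norm_eq_inner)
  ultimately show ?thesis by (simp add: \<Psi>_def)
qed

text \<open>
  The update commutes with a linear change of coordinates: \<open>s\<close> transforms with \<open>S\<^sup>-\<^sup>1\<close>, like a vector, and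
  \<open>y\<close> with \<open>S\<close>, like a gradient.
\<close>
lemma bfgs_update_congruence:
  fixes B S R :: "real^'n^'n"
  assumes B: "transpose B = B" and S: "transpose S = S" and SR: "S ** R = mat 1"
  shows "S ** bfgs_update B s y ** S = bfgs_update (S ** B ** S) (R *v s) (S *v y)"
proof -
  have SRv: "S *v (R *v v) = v" for v
    using SR by (simp add: matrix_vector_mul_assoc)
  have dotS: "(S *v u) \<bullet> v = u \<bullet> (S *v v)" for u v using symmetric_dot[OF S] by simp
  have dotR: "(R *v u) \<bullet> (S *v v) = u \<bullet> v" for u v
    by (metis dotS SRv)
  have sym: "transpose (S ** B ** S) = S ** B ** S"
    by (simp add: matrix_transpose_mul B S matrix_mul_assoc)
  have Bs: "S ** B ** S *v (R *v s) = S *v (B *v s)"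
    by (simp add: SRv flip: matrix_vector_mul_assoc)
  show ?thesis
    unfolding bfgs_update_eq_outer[OF B] bfgs_update_eq_outer[OF sym] Bs dotR
    unfolding matrix_eq
    by (simp add: matrix_vector_mult_add_rdistrib matrix_vector_right_distrib outer_vec dotS
        matrix_vector_mult_diff_distrib matrix_vector_mult_scaleR flip: matrix_vector_mul_assoc)
qed

lemma spd_congruence:
  fixes B S :: "real^'n^'n"
  assumes B: "spd B" and S: "spd S"
  shows "spd (S ** B ** S)"
proof -
  have sS: "transpose S = S" and sB: "transpose B = B" using assms by (auto simp: spd_def)
  have "v \<bullet> (S ** B ** S *v v) > 0" if "v \<noteq> 0" for v
  proof -
    have "S *v v \<noteq> 0"
      using that S unfolding spd_def by fastforce
    then have "(S *v v) \<bullet> (B *v (S *v v)) > 0" using B by (simp add: spd_def)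
    then show ?thesis
      by (simp add: symmetric_dot[OF sS] flip: matrix_vector_mul_assoc)
  qed
  then show ?thesis
    by (simp add: spd_def matrix_transpose_mul sS sB matrix_mul_assoc)
qed

text \<open>
  The form in which the potential is used, with \<open>S\<close> a multiple of the identity and with \<open>S\<close> the inverse
  square root of the Hessian at the minimizer.
\<close>
lemma \<Psi>_congruence_bfgs_update:
  fixes B S R :: "real^'n^'n"
  assumes B: "spd B" and S: "spd S" and SR: "S ** R = mat 1" and sy: "s \<bullet> y > 0"
  shows "\<Psi> (S ** bfgs_update B s y ** S) = \<Psi> (S ** B ** S) - (norm (S *v (B *v s)))\<^sup>2 / (s \<bullet> (B *v s))
    + (norm (S *v y))\<^sup>2 / (s \<bullet> y) - ln ((s \<bullet> y) / (s \<bullet> (B *v s)))"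
proof -
  have sym: "transpose S = S" "transpose B = B" using B S by (auto simp: spd_def)
  have SRv: "S *v (R *v v) = v" for v
    using SR by (simp add: matrix_vector_mul_assoc)
  have dot: "(R *v u) \<bullet> (S *v v) = u \<bullet> v" for u v
    by (simp add: symmetric_dot[OF sym(1)] SRv)
  have Bs: "S ** B ** S *v (R *v s) = S *v (B *v s)"
    by (simp add: SRv flip: matrix_vector_mul_assoc)
  show ?thesis
    unfolding bfgs_update_congruence[OF sym(2,1) SR]
    using \<Psi>_bfgs_update[OF spd_congruence[OF B S], of "R *v s" "S *v y"] sy
    by (simp add: Bs dot)
qed

section \<open>Strongly convex functions with Lipschitz Hessian\<close>

locale smooth_strongly_convex =
  fixes f :: "real^'n \<Rightarrow> real" and \<mu> L M :: real and xstar :: "real^'n"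
  assumes twice_diff: "twice_differentiable f"
    and \<mu>_pos: "\<mu> > 0" and strongly: "strongly_convex \<mu> f"
    and L_pos: "L > 0" and grad_lipschitz: "L-lipschitz_on UNIV (grad f)"
    and M_pos: "M > 0" and hess_lipschitz: "hessian_lipschitz M f"
    and minimizer: "\<And>z. f xstar \<le> f z"
begin

lemma f_has_derivative: "(f has_derivative (\<lambda>h. h \<bullet> grad f x)) (at x)"
proof -
  obtain f' where f': "(f has_derivative f') (at x)"
    using twice_diff by (auto simp: twice_differentiable_def differentiable_def)
  interpret f': bounded_linear f' using f' by (rule has_derivative_bounded_linear)
  have eq: "f' = (\<lambda>h. h \<bullet> adjoint f' 1)"
    by (rule ext) (simp add: adjoint_works f'.linear_axioms)
  have "GDERIV f x :> adjoint f' 1"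
    unfolding gderiv_def eq[symmetric] by (rule f')
  moreover have "D = D'" if "GDERIV f x :> D" "GDERIV f x :> D'" for D D'
  proof -
    have "(\<lambda>h. h \<bullet> D) = (\<lambda>h. h \<bullet> D')"
      using that unfolding gderiv_def by (rule has_derivative_unique)
    then have "(D - D') \<bullet> D = (D - D') \<bullet> D'" by (rule fun_cong)
    then have "(D - D') \<bullet> (D - D') = 0" by (simp add: inner_diff_right)
    then show ?thesis by simp
  qed
  ultimately have "GDERIV f x :> grad f x"
    unfolding grad_def by (intro theI[of "\<lambda>D. GDERIV f x :> D"]) auto
  then show ?thesis by (simp add: gderiv_def)
qed

lemma grad_has_derivative: "(grad f has_derivative (\<lambda>v. hess f x *v v)) (at x)"
proof -
  have "grad f differentiable (at x)" using twice_diff by (simp add: twice_differentiable_def)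
  then have *: "(grad f has_derivative frechet_derivative (grad f) (at x)) (at x)"
    by (simp add: frechet_derivative_works)
  moreover have "frechet_derivative (grad f) (at x) = (\<lambda>v. hess f x *v v)"
    using has_derivative_linear[OF *] by (simp add: hess_def matrix_works)
  ultimately show ?thesis by simp
qed

lemma f_line_derivative:
  "((\<lambda>\<tau>. f (x + \<tau> *\<^sub>R d)) has_real_derivative grad f (x + \<tau> *\<^sub>R d) \<bullet> d) (at \<tau>)"
proof -
  have "((\<lambda>\<tau>. f (x + \<tau> *\<^sub>R d)) has_derivative (\<lambda>h. (h *\<^sub>R d) \<bullet> grad f (x + \<tau> *\<^sub>R d))) (at \<tau>)"
    by (rule has_derivative_compose[OF _ f_has_derivative]) (auto intro!: derivative_eq_intros)
  then show ?thesis
    by (simp add: has_field_derivative_def inner_commute mult.commute cong: if_cong) (simp add: mult_commute_abs)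
qed

lemma grad_line_derivative:
  "((\<lambda>\<tau>. grad f (x + \<tau> *\<^sub>R d) \<bullet> u) has_real_derivative u \<bullet> (hess f (x + \<tau> *\<^sub>R d) *v d)) (at \<tau>)"
proof -
  have "((\<lambda>\<tau>. grad f (x + \<tau> *\<^sub>R d)) has_derivative (\<lambda>h. hess f (x + \<tau> *\<^sub>R d) *v (h *\<^sub>R d))) (at \<tau>)"
    by (rule has_derivative_compose[OF _ grad_has_derivative]) (auto intro!: derivative_eq_intros)
  then have "((\<lambda>\<tau>. grad f (x + \<tau> *\<^sub>R d) \<bullet> u) has_derivative
      (\<lambda>h. (hess f (x + \<tau> *\<^sub>R d) *v (h *\<^sub>R d)) \<bullet> u)) (at \<tau>)"
    by (intro has_derivative_inner_left)
  moreover have "(\<lambda>h. (hess f (x + \<tau> *\<^sub>R d) *v (h *\<^sub>R d)) \<bullet> u) = (*) (u \<bullet> (hess f (x + \<tau> *\<^sub>R d) *v d))"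
    by (auto simp: matrix_vector_mult_scaleR inner_commute)
  ultimately show ?thesis
    by (simp add: has_field_derivative_def)
qed

lemma grad_line_mvt:
  assumes "a < b"
  obtains \<xi> where "a < \<xi>" "\<xi> < b"
    "(grad f (x + b *\<^sub>R d) - grad f (x + a *\<^sub>R d)) \<bullet> u = (b - a) * (u \<bullet> (hess f (x + \<xi> *\<^sub>R d) *v d))"
  using MVT2[OF assms, of "\<lambda>\<tau>. grad f (x + \<tau> *\<^sub>R d) \<bullet> u" "\<lambda>\<tau>. u \<bullet> (hess f (x + \<tau> *\<^sub>R d) *v d)"]
    grad_line_derivative
  by (auto simp: inner_diff_left)

lemma hess_diff_bound: "norm ((hess f z - hess f w) *v v) \<le> M * norm (z - w) * norm v"
proof -
  have "norm ((hess f z - hess f w) *v v) \<le> onorm (\<lambda>v. (hess f z - hess f w) *v v) * norm v"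
    by (intro onorm linear_conv_bounded_linear[THEN iffD1] matrix_vector_mul_linear)
  also have "\<dots> \<le> M * norm (z - w) * norm v"
    using hess_lipschitz by (intro mult_right_mono) (auto simp: hessian_lipschitz_def)
  finally show ?thesis .
qed

lemma hess_form_diff_bound:
  "\<bar>u \<bullet> (hess f z *v v) - u \<bullet> (hess f w *v v)\<bar> \<le> M * norm (z - w) * norm u * norm v"
proof -
  have "\<bar>u \<bullet> ((hess f z - hess f w) *v v)\<bar> \<le> norm u * norm ((hess f z - hess f w) *v v)"
    by (rule Cauchy_Schwarz_ineq2)
  also have "\<dots> \<le> norm u * (M * norm (z - w) * norm v)"
    by (intro mult_left_mono hess_diff_bound) auto
  finally show ?thesis
    by (simp add: matrix_vector_mult_diff_rdistrib inner_diff_right mult_ac)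
qed

text \<open>
  The mean value theorem in the direction \<open>u\<close>, followed by the one in the direction \<open>v\<close>.
\<close>
lemma second_difference_mvt:
  assumes s: "s > 0"
  obtains z where "norm (z - x) \<le> s * (norm u + norm v)"
    "f (x + s *\<^sub>R u + s *\<^sub>R v) - f (x + s *\<^sub>R u) - f (x + s *\<^sub>R v) + f x = s\<^sup>2 * (u \<bullet> (hess f z *v v))"
proof -
  define \<phi> where "\<phi> \<tau> = f ((x + s *\<^sub>R v) + \<tau> *\<^sub>R u) - f (x + \<tau> *\<^sub>R u)" for \<tau>
  have "(\<phi> has_real_derivative (grad f ((x + s *\<^sub>R v) + \<tau> *\<^sub>R u) \<bullet> u - grad f (x + \<tau> *\<^sub>R u) \<bullet> u)) (at \<tau>)" for \<tau>
    unfolding \<phi>_def by (intro derivative_intros f_line_derivative)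
  then obtain \<xi> where \<xi>: "0 < \<xi>" "\<xi> < s"
    "\<phi> s - \<phi> 0 = (s - 0) * (grad f ((x + s *\<^sub>R v) + \<xi> *\<^sub>R u) \<bullet> u - grad f (x + \<xi> *\<^sub>R u) \<bullet> u)"
    using MVT2[OF s, of \<phi> "\<lambda>\<tau>. grad f ((x + s *\<^sub>R v) + \<tau> *\<^sub>R u) \<bullet> u - grad f (x + \<tau> *\<^sub>R u) \<bullet> u"]
    by blast
  obtain \<zeta> where \<zeta>: "0 < \<zeta>" "\<zeta> < s"
    "(grad f ((x + \<xi> *\<^sub>R u) + s *\<^sub>R v) - grad f ((x + \<xi> *\<^sub>R u) + 0 *\<^sub>R v)) \<bullet> u
       = (s - 0) * (u \<bullet> (hess f ((x + \<xi> *\<^sub>R u) + \<zeta> *\<^sub>R v) *v v))"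
    using grad_line_mvt[OF s] by blast
  define z where "z = x + \<xi> *\<^sub>R u + \<zeta> *\<^sub>R v"
  have "norm (z - x) \<le> norm (\<xi> *\<^sub>R u) + norm (\<zeta> *\<^sub>R v)"
    unfolding z_def using norm_triangle_ineq[of "\<xi> *\<^sub>R u" "\<zeta> *\<^sub>R v"] by (simp add: algebra_simps)
  also have "\<dots> \<le> s * (norm u + norm v)"
    using \<xi>(1,2) \<zeta>(1,2) by (simp add: distrib_left add_mono mult_right_mono)
  finally have "norm (z - x) \<le> s * (norm u + norm v)" .
  moreover have "f (x + s *\<^sub>R u + s *\<^sub>R v) - f (x + s *\<^sub>R u) - f (x + s *\<^sub>R v) + f x = \<phi> s - \<phi> 0"
    by (simp add: \<phi>_def algebra_simps)
  moreover have "\<phi> s - \<phi> 0 = s\<^sup>2 * (u \<bullet> (hess f z *v v))"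
    using \<xi>(3) \<zeta>(3) by (simp add: z_def algebra_simps power2_eq_square)
  ultimately show thesis using that by metis
qed

text \<open>
  The second difference is symmetric in \<open>u\<close> and \<open>v\<close>, so the two forms agree up to the variation of the
  Hessian at distance \<open>O(s)\<close>.
\<close>
lemma hess_form_symmetric: "u \<bullet> (hess f x *v v) = v \<bullet> (hess f x *v u)"
proof -
  define D where "D = u \<bullet> (hess f x *v v) - v \<bullet> (hess f x *v u)"
  define K where "K = 2 * (M * (norm u + norm v) * norm u * norm v)"
  have bound: "\<bar>D\<bar> \<le> s * K" if s: "s > 0" for s
  proof -
    obtain z where z: "norm (z - x) \<le> s * (norm u + norm v)"
      "f (x + s *\<^sub>R u + s *\<^sub>R v) - f (x + s *\<^sub>R u) - f (x + s *\<^sub>R v) + f x = s\<^sup>2 * (u \<bullet> (hess f z *v v))"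
      using second_difference_mvt[OF s] by blast
    obtain w where w: "norm (w - x) \<le> s * (norm v + norm u)"
      "f (x + s *\<^sub>R v + s *\<^sub>R u) - f (x + s *\<^sub>R v) - f (x + s *\<^sub>R u) + f x = s\<^sup>2 * (v \<bullet> (hess f w *v u))"
      using second_difference_mvt[OF s] by blast
    have "s\<^sup>2 * (u \<bullet> (hess f z *v v)) = s\<^sup>2 * (v \<bullet> (hess f w *v u))"
      using z(2) w(2) by (simp add: algebra_simps)
    then have eq: "u \<bullet> (hess f z *v v) = v \<bullet> (hess f w *v u)" using s by simp
    have "\<bar>u \<bullet> (hess f z *v v) - u \<bullet> (hess f x *v v)\<bar> \<le> M * (s * (norm u + norm v)) * norm u * norm v"
      by (rule order.trans[OF hess_form_diff_bound])
        (use z(1) M_pos in \<open>intro mult_right_mono mult_left_mono, auto\<close>)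
    moreover have "\<bar>v \<bullet> (hess f w *v u) - v \<bullet> (hess f x *v u)\<bar> \<le> M * (s * (norm v + norm u)) * norm v * norm u"
      by (rule order.trans[OF hess_form_diff_bound])
        (use w(1) M_pos in \<open>intro mult_right_mono mult_left_mono, auto\<close>)
    ultimately have "\<bar>D\<bar> \<le> M * (s * (norm u + norm v)) * norm u * norm v + M * (s * (norm v + norm u)) * norm v * norm u"
      unfolding D_def using eq by linarith
    then show ?thesis by (simp add: K_def algebra_simps)
  qed
  have "((\<lambda>s. s * K) \<longlongrightarrow> 0 * K) (at_right 0)" by (intro tendsto_intros)
  moreover have "\<forall>\<^sub>F s in at_right 0. \<bar>D\<bar> \<le> s * K"
    using bound by (auto simp: eventually_at_right[of 0 1] intro!: exI[of _ 1])
  ultimately have "\<bar>D\<bar> \<le> 0"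
    by (metis mult_zero_left tendsto_lowerbound trivial_limit_at_right_real)
  then show ?thesis by (simp add: D_def)
qed

lemma hess_symmetric: "transpose (hess f x) = hess f x"
proof -
  have "axis i 1 \<bullet> (hess f x *v axis j 1) = hess f x $ i $ j" for i j
    by (simp add: inner_axis' matrix_vector_mult_basis column_def)
  then show ?thesis
    using hess_form_symmetric[of "axis _ 1" x "axis _ 1"] by (simp add: transpose_def vec_eq_iff)
qed

lemma strongly_convex_tangent:
  "f x + grad f x \<bullet> (y - x) + \<mu> / 2 * (norm (y - x))\<^sup>2 \<le> f y"
proof -
  define d where "d = y - x"
  define N where "N = \<mu> / 2 * (norm d)\<^sup>2"
  have "(N - (f y - f x)) * \<tau> - N * \<tau>\<^sup>2 \<le> - f (x + \<tau> *\<^sub>R d) - (- f (x + 0 *\<^sub>R d))" if "0 < \<tau>" "\<tau> < 1" for \<tau>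
  proof -
    have "f ((1 - \<tau>) *\<^sub>R x + \<tau> *\<^sub>R y) \<le> (1 - \<tau>) * f x + \<tau> * f y - \<mu> / 2 * (1 - \<tau>) * \<tau> * (norm (x - y))\<^sup>2"
      using strongly that unfolding strongly_convex_def by (metis add_diff_cancel_left' diff_add_cancel diff_ge_0_iff_ge less_imp_le)
    moreover have "(1 - \<tau>) *\<^sub>R x + \<tau> *\<^sub>R y = x + \<tau> *\<^sub>R d" by (simp add: d_def algebra_simps)
    moreover have "\<mu> / 2 * (1 - \<tau>) * \<tau> * (norm (x - y))\<^sup>2 = N * \<tau> - N * \<tau>\<^sup>2"
      unfolding N_def d_def norm_minus_commute[of y x] by (simp add: field_simps power2_eq_square)
    ultimately show ?thesis
      by (simp add: algebra_simps)
  qed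
  then have "N - (f y - f x) \<le> - (grad f (x + 0 *\<^sub>R d) \<bullet> d)"
    by (rule real_derivative_ge_slope[OF DERIV_minus[OF f_line_derivative]])
  then show ?thesis by (simp add: N_def d_def)
qed

lemma grad_strongly_monotone: "\<mu> * (norm (y - x))\<^sup>2 \<le> (grad f y - grad f x) \<bullet> (y - x)"
  using strongly_convex_tangent[of x y] strongly_convex_tangent[of y x]
  by (simp add: norm_minus_commute algebra_simps)

lemma hess_lower: "\<mu> * (norm v)\<^sup>2 \<le> v \<bullet> (hess f x *v v)"
proof -
  have "(\<mu> * (norm v)\<^sup>2) * \<tau> - 0 * \<tau>\<^sup>2 \<le> grad f (x + \<tau> *\<^sub>R v) \<bullet> v - grad f (x + 0 *\<^sub>R v) \<bullet> v"
    if "0 < \<tau>" "\<tau> < 1" for \<tau>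
  proof -
    have "\<tau> * (\<mu> * (norm v)\<^sup>2 * \<tau>) \<le> \<tau> * ((grad f (x + \<tau> *\<^sub>R v) - grad f x) \<bullet> v)"
      using grad_strongly_monotone[of "x + \<tau> *\<^sub>R v" x]
      by (simp add: power_mult_distrib power2_eq_square mult_ac)
    then have "\<mu> * (norm v)\<^sup>2 * \<tau> \<le> (grad f (x + \<tau> *\<^sub>R v) - grad f x) \<bullet> v"
      using that by simp
    then show ?thesis by (simp add: inner_diff_left)
  qed
  from real_derivative_ge_slope[OF grad_line_derivative this] show ?thesis by simp
qed

lemma hess_upper: "v \<bullet> (hess f x *v v) \<le> L * (norm v)\<^sup>2"
proof -
  have "(- (L * (norm v)\<^sup>2)) * \<tau> - 0 * \<tau>\<^sup>2 \<le> - (grad f (x + \<tau> *\<^sub>R v) \<bullet> v) - (- (grad f (x + 0 *\<^sub>R v) \<bullet> v))"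
    if "0 < \<tau>" "\<tau> < 1" for \<tau>
  proof -
    have "(grad f (x + \<tau> *\<^sub>R v) - grad f x) \<bullet> v \<le> norm (grad f (x + \<tau> *\<^sub>R v) - grad f x) * norm v"
      by (rule norm_cauchy_schwarz)
    also have "\<dots> \<le> (L * norm (\<tau> *\<^sub>R v)) * norm v"
      using lipschitz_onD[OF grad_lipschitz, of "x + \<tau> *\<^sub>R v" x]
      by (intro mult_right_mono) (auto simp: dist_norm)
    finally show ?thesis using that by (simp add: power2_eq_square inner_diff_left algebra_simps)
  qed
  from real_derivative_ge_slope[OF DERIV_minus[OF grad_line_derivative] this] show ?thesis by simp
qed

lemma hess_spd: "spd (hess f x)"
proof -
  have "v \<bullet> (hess f x *v v) > 0" if "v \<noteq> 0" for v
    using hess_lower[of v x] that \<mu>_pos by (smt (verit) mult_pos_pos zero_less_norm_iff zero_less_power)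
  then show ?thesis by (simp add: spd_def hess_symmetric)
qed

lemma \<mu>_le_L: "\<mu> \<le> L"
proof -
  have "\<mu> * (norm (axis k 1 :: real^'n))\<^sup>2 \<le> L * (norm (axis k 1 :: real^'n))\<^sup>2" for k
    using hess_lower[of "axis k 1" 0] hess_upper[of "axis k 1" 0] by linarith
  then show ?thesis by simp
qed

lemma grad_xstar: "grad f xstar = 0"
proof -
  have "0 * \<tau> - 0 * \<tau>\<^sup>2 \<le> f (xstar + \<tau> *\<^sub>R (- grad f xstar)) - f (xstar + 0 *\<^sub>R (- grad f xstar))"
    if "0 < \<tau>" "\<tau> < 1" for \<tau>
    using minimizer by simp
  from real_derivative_ge_slope[OF f_line_derivative this]
  have "grad f xstar \<bullet> grad f xstar \<le> 0" by simp
  then show ?thesis by (metis inner_gt_zero_iff not_less)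
qed

text \<open>
  The tangent inequality at \<open>x\<close>, evaluated at the minimizer; completing the square bounds the quadratic
  in the displacement from below.
\<close>
lemma polyak_lojasiewicz: "2 * \<mu> * (f x - f xstar) \<le> (norm (grad f x))\<^sup>2"
proof -
  define d where "d = xstar - x"
  have "0 \<le> (norm (grad f x + \<mu> *\<^sub>R d))\<^sup>2" by simp
  also have "\<dots> = (norm (grad f x))\<^sup>2 + 2 * \<mu> * (grad f x \<bullet> d + \<mu> / 2 * (norm d)\<^sup>2)"
    by (simp add: power2_norm_eq_inner algebra_simps inner_commute)
  also have "\<dots> \<le> (norm (grad f x))\<^sup>2 + 2 * \<mu> * (f xstar - f x)"
    using strongly_convex_tangent[of x xstar] \<mu>_pos
    by (intro add_left_mono mult_left_mono) (auto simp: d_def)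
  finally show ?thesis by (simp add: algebra_simps)
qed

text \<open>
  The dimensionless distance to optimality called \<open>C\<close> in the theorem. It bounds \<open>M / \<mu>\<close> times the distance
  to the minimizer (\<open>dist_xstar_le_deviation\<close>), hence the relative variation of the Hessian.
\<close>
definition deviation :: "real^'n \<Rightarrow> real" where
  "deviation x = M / \<mu> powr (3 / 2) * sqrt (2 * (f x - f xstar))"

lemma deviation_nonneg: "0 \<le> deviation x"
  using M_pos minimizer[of x] by (simp add: deviation_def)

lemma dist_xstar_le_deviation:
  assumes "f z \<le> f x"
  shows "M / \<mu> * norm (z - xstar) \<le> deviation x"
proof -
  have "\<mu> / 2 * (norm (z - xstar))\<^sup>2 \<le> f x - f xstar"
    using strongly_convex_tangent[of xstar z] assms by (simp add: grad_xstar)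
  then have "(norm (z - xstar))\<^sup>2 \<le> 2 * (f x - f xstar) / \<mu>"
    using \<mu>_pos by (simp add: field_simps)
  then have "norm (z - xstar) \<le> sqrt (2 * (f x - f xstar) / \<mu>)"
    by (rule real_le_rsqrt)
  then have "M / \<mu> * norm (z - xstar) \<le> M / \<mu> * (sqrt (2 * (f x - f xstar)) / sqrt \<mu>)"
    unfolding real_sqrt_divide using M_pos \<mu>_pos by (intro mult_left_mono) auto
  also have "\<dots> = deviation x"
  proof -
    have "\<mu> powr (3 / 2) = \<mu> powr (1 + 1 / 2)" by simp
    also have "\<dots> = \<mu> * sqrt \<mu>" using \<mu>_pos by (subst powr_add) (simp add: powr_half_sqrt)
    finally show ?thesis by (simp add: deviation_def)
  qed
  finally show ?thesis .
qed

text \<open>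
  The Lipschitz bound, made relative by the strong convexity.
\<close>
lemma hess_compare: "v \<bullet> (hess f z *v v) \<le> (1 + M / \<mu> * norm (z - w)) * (v \<bullet> (hess f w *v v))"
proof -
  have "v \<bullet> (hess f z *v v) \<le> v \<bullet> (hess f w *v v) + M * norm (z - w) * norm v * norm v"
    using hess_form_diff_bound[of v z v w] by linarith
  also have "M * norm (z - w) * norm v * norm v = M / \<mu> * norm (z - w) * (\<mu> * (norm v)\<^sup>2)"
    using \<mu>_pos by (simp add: power2_eq_square)
  also have "\<dots> \<le> M / \<mu> * norm (z - w) * (v \<bullet> (hess f w *v v))"
    using M_pos \<mu>_pos by (intro mult_left_mono hess_lower) auto
  finally show ?thesis by (simp add: algebra_simps)
qed

lemma hess_form_nonneg: "0 \<le> v \<bullet> (hess f z *v v)"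
  using hess_lower[of v z] \<mu>_pos by (smt (verit) mult_nonneg_nonneg zero_le_power2)

lemma hess_compare_xstar:
  assumes "f z \<le> f x"
  shows "v \<bullet> (hess f z *v v) \<le> (1 + deviation x) * (v \<bullet> (hess f xstar *v v))"
    and "v \<bullet> (hess f xstar *v v) \<le> (1 + deviation x) * (v \<bullet> (hess f z *v v))"
proof -
  note le = dist_xstar_le_deviation[OF assms]
  show "v \<bullet> (hess f z *v v) \<le> (1 + deviation x) * (v \<bullet> (hess f xstar *v v))"
    by (rule order.trans[OF hess_compare[of v z xstar]])
      (use le in \<open>auto intro!: mult_right_mono hess_form_nonneg\<close>)
  show "v \<bullet> (hess f xstar *v v) \<le> (1 + deviation x) * (v \<bullet> (hess f z *v v))"
    by (rule order.trans[OF hess_compare[of v xstar z]])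
      (use le in \<open>auto intro!: mult_right_mono hess_form_nonneg simp: norm_minus_commute\<close>)
qed

text \<open>
  Comparing the two Hessians directly, rather than both with the one at the minimizer, gives the factor
  \<open>1 + 2C\<close> instead of \<open>(1 + C)\<^sup>2\<close>.
\<close>
lemma hess_compare_sublevel:
  assumes "f z \<le> f x" "f w \<le> f x"
  shows "v \<bullet> (hess f z *v v) \<le> (1 + 2 * deviation x) * (v \<bullet> (hess f w *v v))"
proof -
  have "norm (z - w) \<le> norm (z - xstar) + norm (w - xstar)"
    by (metis dist_norm dist_triangle2)
  then have "M / \<mu> * norm (z - w) \<le> M / \<mu> * (norm (z - xstar) + norm (w - xstar))"
    using M_pos \<mu>_pos by (intro mult_left_mono) auto
  also have "\<dots> \<le> 2 * deviation x"
    using dist_xstar_le_deviation[OF assms(1)] dist_xstar_le_deviation[OF assms(2)]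
    by (simp add: distrib_left)
  finally show ?thesis
    by (intro order.trans[OF hess_compare[of v z w]] mult_right_mono hess_form_nonneg) auto
qed

lemma convex_segment:
  assumes b: "b > 0" and "0 \<le> \<xi>" "\<xi> \<le> b"
  shows "f (x + \<xi> *\<^sub>R d) \<le> (1 - \<xi> / b) * f x + \<xi> / b * f (x + b *\<^sub>R d)"
proof -
  define v where "v = \<xi> / b"
  have v: "0 \<le> v" "v \<le> 1" "v * b = \<xi>" using assms by (auto simp: v_def)
  have "f ((1 - v) *\<^sub>R x + v *\<^sub>R (x + b *\<^sub>R d)) \<le> (1 - v) * f x + v * f (x + b *\<^sub>R d)
     - \<mu> / 2 * (1 - v) * v * (norm (x - (x + b *\<^sub>R d)))\<^sup>2"
    using strongly v(1,2) unfolding strongly_convex_def by (metis add_diff_cancel_left' diff_add_cancel diff_ge_0_iff_ge)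
  moreover have "(1 - v) *\<^sub>R x + v *\<^sub>R (x + b *\<^sub>R d) = x + \<xi> *\<^sub>R d"
    by (simp add: algebra_simps flip: v(3))
  moreover have "0 \<le> \<mu> / 2 * (1 - v) * v * (norm (x - (x + b *\<^sub>R d)))\<^sup>2"
    using v \<mu>_pos by simp
  ultimately show ?thesis by (simp add: v_def)
qed

lemma sublevel_segment:
  assumes "f (x + b *\<^sub>R d) \<le> f x" "0 \<le> \<xi>" "\<xi> \<le> b"
  shows "f (x + \<xi> *\<^sub>R d) \<le> f x"
proof (cases "b = 0")
  case False
  then have b: "b > 0" using assms by simp
  have "f (x + \<xi> *\<^sub>R d) \<le> (1 - \<xi> / b) * f x + \<xi> / b * f (x + b *\<^sub>R d)"
    by (rule convex_segment[OF b assms(2,3)])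
  also have "\<dots> \<le> (1 - \<xi> / b) * f x + \<xi> / b * f x"
    using b assms by (intro add_left_mono mult_left_mono) auto
  finally show ?thesis by (simp add: algebra_simps)
qed (use assms in auto)

text \<open>
  If \<open>J\<close> is the average of the Hessian over the segment, then \<open>y = J s\<close> and the claim says that
  \<open>J P\<^sup>-\<^sup>1 J \<le> c J\<close>, which follows from \<open>J \<le> c P\<close>. The proof avoids the average. By duality it
  suffices that \<open>2 (y \<bullet> u) - s \<bullet> y \<le> c (u \<bullet> P u)\<close> for all \<open>u\<close>, and for a single \<open>u\<close> this follows from the
  mean value theorem for the gradient in the direction \<open>2 u - s\<close>. With \<open>P = I\<close> and \<open>c = L\<close> it is the
  cocoercivity of the gradient.
\<close>
lemma grad_difference_bound:
  fixes P Q :: "real^'n^'n"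
  assumes PQ: "P ** Q = mat 1" and c: "c > 0"
    and le: "\<And>\<xi> u. 0 \<le> \<xi> \<Longrightarrow> \<xi> \<le> 1 \<Longrightarrow> u \<bullet> (hess f (x + \<xi> *\<^sub>R s) *v u) \<le> c * (u \<bullet> (P *v u))"
  defines "y \<equiv> grad f (x + s) - grad f x"
  shows "y \<bullet> (Q *v y) \<le> c * (s \<bullet> y)"
proof -
  have key: "2 * (y \<bullet> u) - s \<bullet> y \<le> c * (u \<bullet> (P *v u))" for u
  proof -
    obtain \<xi> where \<xi>: "0 < \<xi>" "\<xi> < 1"
      "(grad f (x + 1 *\<^sub>R s) - grad f (x + 0 *\<^sub>R s)) \<bullet> (2 *\<^sub>R u - s)
         = (1 - 0) * ((2 *\<^sub>R u - s) \<bullet> (hess f (x + \<xi> *\<^sub>R s) *v s))"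
      using grad_line_mvt[of 0 1] by (metis zero_less_one)
    define H where "H = hess f (x + \<xi> *\<^sub>R s)"
    have "2 * (y \<bullet> u) - s \<bullet> y = (2 *\<^sub>R u - s) \<bullet> (H *v s)"
      using \<xi>(3) by (simp add: y_def H_def inner_diff_right inner_diff_left inner_commute)
    also have "\<dots> = u \<bullet> (H *v u) - (u - s) \<bullet> (H *v (u - s))"
      using hess_form_symmetric[of s "x + \<xi> *\<^sub>R s" u] by (simp add: H_def algebra_simps)
    also have "\<dots> \<le> u \<bullet> (H *v u)" by (simp add: H_def hess_form_nonneg)
    also have "\<dots> \<le> c * (u \<bullet> (P *v u))" using le[of \<xi> u] \<xi>(1,2) by (simp add: H_def)
    finally show ?thesis .
  qed
  define a where "a = y \<bullet> (Q *v y)"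
  have "P *v (Q *v y) = y" using PQ by (simp add: matrix_vector_mul_assoc)
  \<comment> \<open>the choice \<open>u = Q y / c\<close> maximizes \<open>2 (y \<bullet> u) - c (u \<bullet> P u)\<close>\<close>
  then have "2 * (a / c) - s \<bullet> y \<le> c * ((1 / c) * ((1 / c) * a))"
    using key[of "(1 / c) *\<^sub>R (Q *v y)"] by (simp add: a_def matrix_vector_mult_scaleR inner_commute)
  then show ?thesis using c by (simp add: a_def field_simps)
qed

lemma grad_difference_lower:
  assumes le: "\<And>\<xi>. 0 \<le> \<xi> \<Longrightarrow> \<xi> \<le> 1 \<Longrightarrow> r \<le> s \<bullet> (hess f (x + \<xi> *\<^sub>R s) *v s)"
  shows "r \<le> s \<bullet> (grad f (x + s) - grad f x)"
proof -
  obtain \<xi> where \<xi>: "0 < \<xi>" "\<xi> < 1"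
    "(grad f (x + 1 *\<^sub>R s) - grad f (x + 0 *\<^sub>R s)) \<bullet> s = (1 - 0) * (s \<bullet> (hess f (x + \<xi> *\<^sub>R s) *v s))"
    using grad_line_mvt[of 0 1] by (metis zero_less_one)
  then show ?thesis using le[of \<xi>] by (simp add: inner_commute)
qed

end

section \<open>Log bisection along a descent direction\<close>

locale line_search = smooth_strongly_convex f \<mu> L M xstar
  for f :: "real^'n \<Rightarrow> real" and \<mu> L M :: real and xstar :: "real^'n" +
  fixes \<alpha> \<beta> :: real and x d :: "real^'n"
  assumes \<alpha>_pos: "0 < \<alpha>" and \<alpha>_less_\<beta>: "\<alpha> < \<beta>" and \<beta>_less_1: "\<beta> < 1" and \<alpha>_less_half: "\<alpha> < 1 / 2"
    and descent: "grad f x \<bullet> d < 0"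
begin

abbreviation SD :: "real \<Rightarrow> bool" where "SD \<equiv> sufficient_decrease f \<alpha> x d"
abbreviation CC :: "real \<Rightarrow> bool" where "CC \<equiv> curvature_condition f \<beta> x d"

definition initial_descent :: real where "initial_descent = - (grad f x \<bullet> d)"
text \<open>
  The minimizing step of the quadratic model of \<open>f\<close> along \<open>d\<close> with the Hessian taken at \<open>xstar\<close>.
\<close>
definition \<rho> :: real where "\<rho> = initial_descent / (d \<bullet> (hess f xstar *v d))"

lemma initial_descent_pos: "initial_descent > 0" using descent by (simp add: initial_descent_def)

lemma hess_d_pos: "d \<bullet> (hess f z *v d) > 0"
proof -
  have "d \<noteq> 0" using descent by auto
  then show ?thesis using hess_spd[of z] by (simp add: spd_def)
qed

lemma \<rho>_pos: "\<rho> > 0"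
  using initial_descent_pos hess_d_pos by (simp add: \<rho>_def)

lemma slope_mono: "a \<le> b \<Longrightarrow> grad f (x + a *\<^sub>R d) \<bullet> d \<le> grad f (x + b *\<^sub>R d) \<bullet> d"
  by (rule DERIV_nonneg_imp_nondecreasing) (use grad_line_derivative hess_form_nonneg in blast)+

lemma line_tangent: "f (x + b *\<^sub>R d) - f x \<le> b * (grad f (x + b *\<^sub>R d) \<bullet> d)"
proof -
  have "0 \<le> \<mu> / 2 * (norm (x - (x + b *\<^sub>R d)))\<^sup>2" using \<mu>_pos by simp
  then show ?thesis using strongly_convex_tangent[of "x + b *\<^sub>R d" x] by simp
qed

lemma SD_imp_sublevel: "SD b \<Longrightarrow> 0 \<le> b \<Longrightarrow> f (x + b *\<^sub>R d) \<le> f x"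
  using mult_nonneg_nonneg[of "\<alpha> * b" initial_descent] \<alpha>_pos initial_descent_pos by (simp add: sufficient_decrease_def initial_descent_def)

lemma not_CC_imp_SD:
  assumes "\<not> CC b" "0 \<le> b"
  shows "SD b"
proof -
  have "b * (grad f (x + b *\<^sub>R d) \<bullet> d) \<le> b * (\<beta> * - initial_descent)"
    using assms by (intro mult_left_mono) (auto simp: curvature_condition_def initial_descent_def)
  also have "\<dots> \<le> b * (\<alpha> * - initial_descent)"
    using assms(2) initial_descent_pos \<alpha>_less_\<beta> by (intro mult_left_mono) auto
  finally show ?thesis using line_tangent[of b] by (simp add: sufficient_decrease_def initial_descent_def algebra_simps)
qed

text \<open>
  The sufficient decrease condition is an equality at some step \<open>a'\<close> before \<open>a\<close>. Up to \<open>a'\<close> the line stays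
  in the sublevel set of \<open>x\<close>, where Hessians are comparable; nothing of the kind is known at \<open>a\<close> itself.
\<close>
lemma SD_crossing:
  assumes "\<not> SD a" "0 < a"
  obtains a' where "0 < a'" "a' \<le> a" "f (x + a' *\<^sub>R d) = f x - \<alpha> * a' * initial_descent"
    "- \<alpha> * initial_descent \<le> grad f (x + a' *\<^sub>R d) \<bullet> d"
proof -
  define h where "h \<tau> = f (x + \<tau> *\<^sub>R d) - f x + \<alpha> * \<tau> * initial_descent" for \<tau>
  have dh: "(h has_real_derivative (grad f (x + \<tau> *\<^sub>R d) \<bullet> d + \<alpha> * initial_descent)) (at \<tau>)" for \<tau>
    unfolding h_def by (rule derivative_eq_intros f_line_derivative refl | simp)+
  have "grad f (x + 0 *\<^sub>R d) \<bullet> d + \<alpha> * initial_descent < 0"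
    using initial_descent_pos \<alpha>_less_half by (simp add: initial_descent_def)
  from DERIV_neg_dec_right[OF dh this] obtain \<delta> where \<delta>: "\<delta> > 0" "\<And>e. 0 < e \<Longrightarrow> e < \<delta> \<Longrightarrow> h e < h 0"
    by auto
  define e where "e = min a (\<delta> / 2)"
  have e: "0 < e" "e \<le> a" "h e < 0"
    using \<delta> assms(2) by (auto simp: e_def h_def[of 0] min_def)
  have "h a > 0" using assms(1) by (simp add: h_def sufficient_decrease_def initial_descent_def)
  have "continuous_on {e..a} h"
    using dh by (intro DERIV_continuous_on) (auto intro: has_field_derivative_at_within)
  with e \<open>h a > 0\<close> obtain a' where a': "e \<le> a'" "a' \<le> a" "h a' = 0"
    using IVT'[of h e 0 a] by auto
  then have "0 < a'" using e by simp
  have "f (x + a' *\<^sub>R d) = f x - \<alpha> * a' * initial_descent" using a'(3) by (simp add: h_def)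
  moreover from this have "a' * (- \<alpha> * initial_descent) \<le> a' * (grad f (x + a' *\<^sub>R d) \<bullet> d)"
    using line_tangent[of a'] by (simp add: algebra_simps)
  then have "- \<alpha> * initial_descent \<le> grad f (x + a' *\<^sub>R d) \<bullet> d"
    using \<open>0 < a'\<close> by (simp only: mult_le_cancel_left_pos)
  ultimately show thesis using that \<open>0 < a'\<close> a'(2) by blast
qed

lemma crossing_sublevel:
  assumes "f (x + a' *\<^sub>R d) = f x - \<alpha> * a' * initial_descent" "0 \<le> \<xi>" "\<xi> \<le> a'"
  shows "f (x + \<xi> *\<^sub>R d) \<le> f x"
  using assms \<alpha>_pos initial_descent_pos by (intro sublevel_segment[OF _ assms(2,3)]) simp

text \<open>
  Between \<open>0\<close> and \<open>b\<close> the slope rises by at most \<open>(1 - \<beta>)\<close>, and between \<open>b\<close> and the crossing \<open>a'\<close> by at least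
  \<open>(\<beta> - \<alpha>)\<close>, in units of the initial descent. By the mean value theorem the rises are the lengths of the
  intervals times values of the form of the Hessian at \<open>d\<close>, and these compare up to \<open>1 + 2C\<close>.
\<close>
lemma not_SD_over_not_CC:
  assumes a: "\<not> SD a" "0 < a" and b: "\<not> CC b" "0 < b"
  shows "1 + (\<beta> - \<alpha>) / ((1 - \<beta>) * (1 + 2 * deviation x)) \<le> a / b"
proof -
  obtain a' where a': "0 < a'" "a' \<le> a" "f (x + a' *\<^sub>R d) = f x - \<alpha> * a' * initial_descent"
    "- \<alpha> * initial_descent \<le> grad f (x + a' *\<^sub>R d) \<bullet> d"
    using SD_crossing[OF a] by blast
  have slope_b: "grad f (x + b *\<^sub>R d) \<bullet> d < - \<beta> * initial_descent"
    using b(1) by (simp add: curvature_condition_def initial_descent_def)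
  have "- \<beta> * initial_descent < - \<alpha> * initial_descent" using \<alpha>_less_\<beta> initial_descent_pos by simp
  then have "b < a'"
    using slope_mono[of a' b] a'(4) slope_b by linarith
  obtain \<xi> where \<xi>: "b < \<xi>" "\<xi> < a'"
    "(grad f (x + a' *\<^sub>R d) - grad f (x + b *\<^sub>R d)) \<bullet> d = (a' - b) * (d \<bullet> (hess f (x + \<xi> *\<^sub>R d) *v d))"
    using grad_line_mvt[OF \<open>b < a'\<close>] by blast
  obtain \<zeta> where \<zeta>: "0 < \<zeta>" "\<zeta> < b"
    "(grad f (x + b *\<^sub>R d) - grad f (x + 0 *\<^sub>R d)) \<bullet> d = (b - 0) * (d \<bullet> (hess f (x + \<zeta> *\<^sub>R d) *v d))"
    using grad_line_mvt[OF b(2)] by blast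
  define K where "K = 1 + 2 * deviation x"
  have K: "K > 0" using deviation_nonneg[of x] by (simp add: K_def)
  define h1 h2 where "h1 = d \<bullet> (hess f (x + \<xi> *\<^sub>R d) *v d)" and "h2 = d \<bullet> (hess f (x + \<zeta> *\<^sub>R d) *v d)"
  have h2: "h2 > 0" by (simp add: h2_def hess_d_pos)
  have "h1 \<le> K * h2"
    unfolding h1_def h2_def K_def using \<xi> \<zeta> \<open>b < a'\<close>
    by (intro hess_compare_sublevel crossing_sublevel[OF a'(3)]) auto
  have "(\<beta> - \<alpha>) * initial_descent \<le> (a' - b) * h1"
    using \<xi>(3) slope_b a'(4) by (simp add: h1_def inner_diff_left algebra_simps)
  also have "\<dots> \<le> (a' - b) * (K * h2)"
    using \<open>h1 \<le> K * h2\<close> \<open>b < a'\<close> by (intro mult_left_mono) auto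
  finally have 1: "(\<beta> - \<alpha>) * initial_descent \<le> (a' - b) * (K * h2)" .
  have 2: "b * h2 \<le> (1 - \<beta>) * initial_descent"
    using \<zeta>(3) slope_b by (simp add: h2_def inner_diff_left initial_descent_def algebra_simps)
  have "(\<beta> - \<alpha>) * (b * h2) \<le> (\<beta> - \<alpha>) * ((1 - \<beta>) * initial_descent)"
    using 2 \<alpha>_less_\<beta> by (intro mult_left_mono) auto
  also have "\<dots> = (1 - \<beta>) * ((\<beta> - \<alpha>) * initial_descent)" by simp
  also have "\<dots> \<le> (1 - \<beta>) * ((a' - b) * (K * h2))"
    using 1 \<beta>_less_1 by (intro mult_left_mono) auto
  finally have "h2 * ((\<beta> - \<alpha>) * b) \<le> h2 * ((1 - \<beta>) * K * (a' - b))"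
    by (simp add: mult_ac)
  then have "(\<beta> - \<alpha>) * b \<le> (1 - \<beta>) * K * (a' - b)"
    using h2 by (simp only: mult_le_cancel_left_pos)
  also have "\<dots> \<le> (1 - \<beta>) * K * (a - b)"
    using a'(2) K \<beta>_less_1 by (intro mult_left_mono) auto
  finally have "(\<beta> - \<alpha>) / ((1 - \<beta>) * K) \<le> (a - b) / b"
    using K \<beta>_less_1 b(2) by (simp add: field_simps)
  then show ?thesis using b(2) by (simp add: K_def diff_divide_distrib)
qed

text \<open>
  Up to the crossing the second derivative along the line is at most \<open>K\<close>, so the value at the crossing
  \<open>a'\<close> is at most that of the parabola with curvature \<open>K\<close>. Bounding only the slope at \<open>a'\<close> would lose the
  factor \<open>2\<close>, for which \<open>scale_bound\<close> leaves no room.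
\<close>
lemma not_SD_lower:
  assumes a: "\<not> SD a" "0 < a"
  shows "2 * (1 - \<alpha>) * \<rho> / (1 + deviation x) \<le> a"
proof -
  obtain a' where a': "0 < a'" "a' \<le> a" "f (x + a' *\<^sub>R d) = f x - \<alpha> * a' * initial_descent"
    using SD_crossing[OF a] by blast
  define q where "q = d \<bullet> (hess f xstar *v d)"
  have q: "q > 0" by (simp add: q_def hess_d_pos)
  define K where "K = (1 + deviation x) * q"
  have K: "K > 0" using q deviation_nonneg[of x] by (simp add: K_def)
  have slope: "grad f (x + \<tau> *\<^sub>R d) \<bullet> d \<le> - initial_descent + K * \<tau>" if \<tau>: "0 < \<tau>" "\<tau> < a'" for \<tau>
  proof -
    obtain \<xi> where \<xi>: "0 < \<xi>" "\<xi> < \<tau>"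
      "(grad f (x + \<tau> *\<^sub>R d) - grad f (x + 0 *\<^sub>R d)) \<bullet> d = (\<tau> - 0) * (d \<bullet> (hess f (x + \<xi> *\<^sub>R d) *v d))"
      using grad_line_mvt[OF \<tau>(1)] by blast
    have "d \<bullet> (hess f (x + \<xi> *\<^sub>R d) *v d) \<le> K"
      unfolding K_def q_def using \<xi> \<tau> by (intro hess_compare_xstar crossing_sublevel[OF a'(3)]) auto
    then have "\<tau> * (d \<bullet> (hess f (x + \<xi> *\<^sub>R d) *v d)) \<le> \<tau> * K"
      using \<tau> by (intro mult_left_mono) auto
    then show ?thesis using \<xi>(3) by (simp add: inner_diff_left initial_descent_def mult.commute)
  qed
  define \<psi> where "\<psi> \<tau> = f (x + \<tau> *\<^sub>R d) + initial_descent * \<tau> - K * \<tau>\<^sup>2 / 2" for \<tau>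
  have "(\<psi> has_real_derivative (grad f (x + \<tau> *\<^sub>R d) \<bullet> d + initial_descent - K * \<tau>)) (at \<tau>)" for \<tau>
    unfolding \<psi>_def by (rule derivative_eq_intros f_line_derivative refl | simp)+
  then obtain \<tau> where \<tau>: "0 < \<tau>" "\<tau> < a'" "\<psi> a' - \<psi> 0 = (a' - 0) * (grad f (x + \<tau> *\<^sub>R d) \<bullet> d + initial_descent - K * \<tau>)"
    using MVT2[OF a'(1), of \<psi> "\<lambda>\<tau>. grad f (x + \<tau> *\<^sub>R d) \<bullet> d + initial_descent - K * \<tau>"] by blast
  then have "\<psi> a' - \<psi> 0 \<le> 0"
    using slope[OF \<tau>(1,2)] a'(1) by (simp add: mult_nonneg_nonpos)
  then have "a' * (2 * (1 - \<alpha>) * initial_descent) \<le> a' * (K * a')"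
    using a'(3) by (simp add: \<psi>_def algebra_simps power2_eq_square)
  then have "2 * (1 - \<alpha>) * initial_descent \<le> K * a'"
    using a'(1) by (simp only: mult_le_cancel_left_pos)
  also have "\<dots> \<le> K * a" using a'(2) K by simp
  finally have "2 * (1 - \<alpha>) * initial_descent / K \<le> a" using K by (simp add: field_simps)
  moreover have "2 * (1 - \<alpha>) * initial_descent / K = 2 * (1 - \<alpha>) * \<rho> / (1 + deviation x)"
    by (simp add: \<rho>_def K_def q_def)
  ultimately show ?thesis by simp
qed

lemma not_CC_upper:
  assumes b: "\<not> CC b" "0 < b"
  shows "b \<le> (1 - \<beta>) * (1 + deviation x) * \<rho>"
proof -
  obtain \<xi> where \<xi>: "0 < \<xi>" "\<xi> < b"
    "(grad f (x + b *\<^sub>R d) - grad f (x + 0 *\<^sub>R d)) \<bullet> d = (b - 0) * (d \<bullet> (hess f (x + \<xi> *\<^sub>R d) *v d))"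
    using grad_line_mvt[OF b(2)] by blast
  define q where "q = d \<bullet> (hess f xstar *v d)"
  have q: "q > 0" by (simp add: q_def hess_d_pos)
  have "SD b" using b by (intro not_CC_imp_SD) auto
  then have "f (x + b *\<^sub>R d) \<le> f x" using b(2) by (intro SD_imp_sublevel) auto
  from sublevel_segment[OF this, of \<xi>] have "f (x + \<xi> *\<^sub>R d) \<le> f x"
    using \<xi>(1,2) by simp
  then have "q \<le> (1 + deviation x) * (d \<bullet> (hess f (x + \<xi> *\<^sub>R d) *v d))"
    unfolding q_def by (rule hess_compare_xstar)
  then have "b * q \<le> b * ((1 + deviation x) * (d \<bullet> (hess f (x + \<xi> *\<^sub>R d) *v d)))"
    using b(2) by (intro mult_left_mono) auto
  also have "\<dots> = (1 + deviation x) * (b * (d \<bullet> (hess f (x + \<xi> *\<^sub>R d) *v d)))" by simp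
  also have "\<dots> \<le> (1 + deviation x) * ((1 - \<beta>) * initial_descent)"
    using \<xi>(3) b(1) deviation_nonneg[of x]
    by (intro mult_left_mono) (auto simp: inner_diff_left initial_descent_def curvature_condition_def algebra_simps)
  finally show ?thesis using q by (simp add: \<rho>_def q_def[symmetric] field_simps)
qed

subsection \<open>Two bounds on the brackets\<close>

text \<open>
  Bounds the reciprocal of \<open>log 2\<close> of the ratio of the ends of any bracket (\<open>log2_bracket_ge\<close>).
\<close>
definition spread_bound :: real where
  "spread_bound = 1 + (1 - \<beta>) / (\<beta> - \<alpha>) * (1 + 2 * deviation x)"

text \<open>
  Bounds \<open>3 / 2 * (n + 1)\<close> whenever \<open>(1 / 2) ^ n\<close> is too long or \<open>2 ^ n\<close> is too short a step
  (\<open>trial_exponent_le_scale_bound\<close>), hence the number of loops before a bracket is found.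
\<close>
definition scale_bound :: real where
  "scale_bound = log 2 (16 * (1 - \<alpha>)) + log 2 (1 + deviation x) + deviation x + 5 * (\<rho> - 1 - ln \<rho>)"

lemma spread_bound_ge_1: "spread_bound \<ge> 1"
  using \<alpha>_less_\<beta> \<beta>_less_1 deviation_nonneg[of x] by (simp add: spread_bound_def)

text \<open>
  From \<open>not_SD_over_not_CC\<close> and \<open>ln (1 + r) \<ge> r / (1 + r)\<close>.
\<close>
lemma log2_bracket_ge:
  assumes "\<not> SD a" "0 < a" "\<not> CC b" "0 < b"
  shows "1 / spread_bound \<le> log 2 (a / b)"
proof -
  define r where "r = (\<beta> - \<alpha>) / ((1 - \<beta>) * (1 + 2 * deviation x))"
  have r: "r > 0" using \<alpha>_less_\<beta> \<beta>_less_1 deviation_nonneg[of x] by (simp add: r_def add_pos_nonneg)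
  have "spread_bound = 1 + 1 / r" by (simp add: spread_bound_def r_def)
  then have "1 / spread_bound \<le> log 2 (1 + r)"
    using one_div_one_plus_inverse_le_log2[OF r] by simp
  also have "\<dots> \<le> log 2 (a / b)"
    using not_SD_over_not_CC[OF assms] r by (simp add: r_def)
  finally show ?thesis .
qed

lemma log2_sixteen_times: "0 \<le> log 2 (2 * (1 - \<alpha>))" "log 2 (16 * (1 - \<alpha>)) = 3 + log 2 (2 * (1 - \<alpha>))"
proof -
  show "0 \<le> log 2 (2 * (1 - \<alpha>))" using \<alpha>_less_half by simp
  have "log 2 (8 * (2 * (1 - \<alpha>))) = log 2 8 + log 2 (2 * (1 - \<alpha>))"
    using \<alpha>_less_half by (intro log_mult_pos) auto
  moreover have "log 2 (8::real) = 3" using log_pow_cancel[of "2::real" 3] by simp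
  ultimately show "log 2 (16 * (1 - \<alpha>)) = 3 + log 2 (2 * (1 - \<alpha>))" by simp
qed

lemma scale_bound_ge_3: "scale_bound \<ge> 3"
proof -
  have "0 \<le> log 2 (1 + deviation x)" using deviation_nonneg[of x] by simp
  moreover have "ln \<rho> \<le> \<rho> - 1" using \<rho>_pos by (intro ln_le_minus_one)
  ultimately show ?thesis
    unfolding scale_bound_def log2_sixteen_times(2)
    using log2_sixteen_times(1) deviation_nonneg[of x] by argo
qed

lemma log2_two_times_le_1: "log 2 (2 * (1 - \<alpha>)) \<le> 1"
  using \<alpha>_pos \<alpha>_less_half by (subst log_le_iff) auto

lemma trial_exponent_le_scale_bound:
  assumes "\<not> SD ((1 / 2) ^ n) \<or> \<not> CC (2 ^ n)"
  shows "3 / 2 * (real n + 1) \<le> scale_bound"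
proof -
  define C where "C = deviation x"
  have C: "C \<ge> 0" by (simp add: C_def deviation_nonneg)
  define a where "a = log 2 (2 * (1 - \<alpha>))"
  have a: "0 \<le> a" "a \<le> 1" "log 2 (16 * (1 - \<alpha>)) = 3 + a"
    using log2_sixteen_times log2_two_times_le_1 by (auto simp: a_def)
  note C_bound = log2_one_plus_le[OF C]
  show ?thesis using assms
  proof
    assume "\<not> SD ((1 / 2) ^ n)"
    from not_SD_lower[OF this] have "2 * (1 - \<alpha>) * \<rho> / (1 + C) \<le> (1 / 2) ^ n" by (simp add: C_def)
    then have "log 2 (2 * (1 - \<alpha>) * \<rho> / (1 + C)) \<le> log 2 ((1 / 2) ^ n)"
      using \<rho>_pos C \<alpha>_less_half by (subst log_le_cancel_iff) (auto simp: add_pos_nonneg)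
    also have "\<dots> = - real n" by (simp add: log_nat_power log_divide)
    also have "log 2 (2 * (1 - \<alpha>) * \<rho> / (1 + C)) = a + log 2 \<rho> - log 2 (1 + C)"
      using \<rho>_pos C \<alpha>_less_half by (simp add: a_def log_divide_pos log_mult_pos)
    finally show ?thesis
      unfolding scale_bound_def C_def[symmetric]
      using one_minus_log2_le_convex_gap[OF \<rho>_pos] C_bound a by argo
  next
    assume "\<not> CC (2 ^ n)"
    from not_CC_upper[OF this] have "2 ^ n \<le> (1 - \<beta>) * (1 + C) * \<rho>" by (simp add: C_def)
    also have "\<dots> \<le> (1 - \<alpha>) * (1 + C) * \<rho>"
      using \<rho>_pos C \<alpha>_less_\<beta> by (intro mult_right_mono) auto
    finally have "log 2 (2 ^ n) \<le> log 2 ((1 - \<alpha>) * (1 + C) * \<rho>)"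
      using \<rho>_pos C \<alpha>_less_half by (subst log_le_cancel_iff) (auto simp: add_pos_nonneg)
    also have "(1 - \<alpha>) * (1 + C) * \<rho> = (2 * (1 - \<alpha>)) * (1 + C) * \<rho> / 2" by simp
    also have "log 2 \<dots> = a + log 2 (1 + C) + log 2 \<rho> - 1"
      using \<rho>_pos C \<alpha>_less_half unfolding a_def by (subst log_divide_pos, simp_all add: log_mult_pos)
    finally have "real n + 1 \<le> a + log 2 (1 + C) + log 2 \<rho>" by (simp add: log_nat_power)
    then show ?thesis
      unfolding scale_bound_def C_def[symmetric]
      using log2_le_convex_gap[OF \<rho>_pos] C_bound a by argo
  qed
qed

subsection \<open>The loop invariant\<close>

text \<open>
  The state after \<open>i + 1\<close> rejected trials. Either all of them were too long, or all were too short, or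
  there is a finite bracket whose size in \<open>log 2\<close> was \<open>2 ^ k\<close> when it arose from a trial with exponent
  \<open>2 ^ k - 1\<close> and its successor, and which has been halved in every loop since then.
\<close>
definition bracket :: "nat \<Rightarrow> real \<times> real \<times> ereal \<Rightarrow> bool" where
  "bracket i = (\<lambda>(\<eta>, lo, hi).
     lo = 0 \<and> hi = ereal ((1 / 2) ^ (2 ^ i - 1)) \<and> \<not> SD ((1 / 2) ^ (2 ^ i - 1)) \<and> \<eta> = (1 / 2) ^ (2 ^ Suc i - 1) \<or>
     hi = \<infinity> \<and> lo = 2 ^ (2 ^ i - 1) \<and> \<not> CC lo \<and> \<eta> = 2 ^ (2 ^ Suc i - 1) \<or>
     (\<exists>h k. hi = ereal h \<and> 0 < lo \<and> lo < h \<and> \<not> CC lo \<and> \<not> SD h \<and> \<eta> = sqrt (h * lo) \<and>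
        log 2 (h / lo) = 2 powr (2 * real k + 1 - real i) \<and>
        (\<not> SD ((1 / 2) ^ (2 ^ k - 1)) \<or> \<not> CC (2 ^ (2 ^ k - 1)))))"

lemma log2_geometric_mean:
  assumes "0 < lo" "lo < (h::real)"
  shows "log 2 (sqrt (h * lo) / lo) = log 2 (h / lo) / 2" "log 2 (h / sqrt (h * lo)) = log 2 (h / lo) / 2"
    "lo < sqrt (h * lo)" "sqrt (h * lo) < h"
proof -
  have "log 2 (sqrt (h * lo)) = (log 2 h + log 2 lo) / 2"
    using assms by (simp add: log_def ln_sqrt ln_mult add_divide_distrib)
  then show "log 2 (sqrt (h * lo) / lo) = log 2 (h / lo) / 2" "log 2 (h / sqrt (h * lo)) = log 2 (h / lo) / 2"
    using assms by (simp_all add: log_divide_pos field_simps)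
  show "lo < sqrt (h * lo)" "sqrt (h * lo) < h"
    using assms by (auto intro!: real_less_rsqrt real_less_lsqrt simp: power2_eq_square)
qed

text \<open>
  The size of a new bracket: consecutive trial exponents \<open>2 ^ i - 1\<close> and \<open>2 ^ (i + 1) - 1\<close> differ by \<open>2 ^ i\<close>.
\<close>
lemma log2_power_gap:
  "log 2 ((1 / 2) ^ (2 ^ i - 1) / (1 / 2) ^ (2 ^ Suc i - 1)) = 2 powr (2 * real i + 1 - real (Suc i))"
  "log 2 (2 ^ (2 ^ Suc i - 1) / 2 ^ (2 ^ i - 1)) = 2 powr (2 * real i + 1 - real (Suc i))"
proof -
  have "real (2 ^ Suc i - 1) - real (2 ^ i - 1) = 2 ^ i"
    by (simp add: of_nat_diff)
  moreover have "2 powr (2 * real i + 1 - real (Suc i)) = 2 ^ i"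
    by (simp add: powr_realpow)
  ultimately show
    "log 2 ((1 / 2) ^ (2 ^ i - 1) / (1 / 2) ^ (2 ^ Suc i - 1)) = 2 powr (2 * real i + 1 - real (Suc i))"
    "log 2 (2 ^ (2 ^ Suc i - 1) / 2 ^ (2 ^ i - 1)) = 2 powr (2 * real i + 1 - real (Suc i))"
    by (simp_all add: log_divide_pos log_nat_power)
qed

lemma SD_less_not_SD: "SD b \<Longrightarrow> \<not> SD a \<Longrightarrow> 0 < a \<Longrightarrow> 0 < b \<Longrightarrow> b < a"
proof (rule ccontr)
  assume b: "SD b" "0 < b" and a: "\<not> SD a" "0 < a" and "\<not> b < a"
  then have ab: "a \<le> b" by simp
  have "f (x + a *\<^sub>R d) \<le> (1 - a / b) * f x + a / b * f (x + b *\<^sub>R d)"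
    using a b ab by (intro convex_segment) auto
  also have "\<dots> \<le> (1 - a / b) * f x + a / b * (f x + \<alpha> * b * (grad f x \<bullet> d))"
    using a b by (intro add_left_mono mult_left_mono) (auto simp: sufficient_decrease_def)
  also have "\<dots> = f x + \<alpha> * a * (grad f x \<bullet> d)"
    using b by (simp add: field_simps)
  finally show False using a by (simp add: sufficient_decrease_def)
qed

lemma bracket_invariant:
  assumes "\<And>j. j \<le> i \<Longrightarrow> \<not> returns_at f \<alpha> \<beta> x d j"
  shows "bracket i (log_bisection f \<alpha> \<beta> x d (Suc i))"
  using assms
proof (induction i)
  case 0
  then have "\<not> returns_at f \<alpha> \<beta> x d 0" by simp
  then show ?case
    by (auto simp: returns_at_def trial_step_def bracket_def one_ereal_def)
next
  case (Suc i)
  obtain \<eta> lo hi where st: "log_bisection f \<alpha> \<beta> x d (Suc i) = (\<eta>, lo, hi)"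
    by (metis prod_cases3)
  have inv: "bracket i (\<eta>, lo, hi)" using Suc by (simp add: st[symmetric])
  have "\<not> returns_at f \<alpha> \<beta> x d (Suc i)" using Suc.prems by simp
  then have fail: "\<not> SD \<eta> \<or> \<not> CC \<eta>" by (simp add: returns_at_def trial_step_def st del: log_bisection.simps)
  have step: "log_bisection f \<alpha> \<beta> x d (Suc (Suc i)) =
    (if \<not> SD \<eta> then (if lo = 0 then (1 / 2) ^ (2 ^ Suc (Suc i) - 1) else sqrt (\<eta> * lo), lo, ereal \<eta>)
     else (if hi = \<infinity> then 2 ^ (2 ^ Suc (Suc i) - 1) else sqrt (real_of_ereal hi * \<eta>), \<eta>, hi))"
    using fail by (subst log_bisection.simps(2), subst st) simp
  have halve: "r / 2 = 2 powr (2 * real k + 1 - real (Suc i))" if "r = 2 powr (2 * real k + 1 - real i)" for r k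
  proof -
    have "2 powr (2 * real k + 1 - real i) = 2 powr (1 + (2 * real k + 1 - real (Suc i)))"
      by (simp add: algebra_simps)
    also have "\<dots> = 2 * 2 powr (2 * real k + 1 - real (Suc i))" by (subst powr_add) simp
    finally show ?thesis by (simp add: that)
  qed
  from inv consider
    (A) "lo = 0" "hi = ereal ((1 / 2) ^ (2 ^ i - 1))" "\<not> SD ((1 / 2) ^ (2 ^ i - 1))" "\<eta> = (1 / 2) ^ (2 ^ Suc i - 1)"
  | (B) "hi = \<infinity>" "lo = 2 ^ (2 ^ i - 1)" "\<not> CC lo" "\<eta> = 2 ^ (2 ^ Suc i - 1)"
  | (C) h k where "hi = ereal h" "0 < lo" "lo < h" "\<not> CC lo" "\<not> SD h" "\<eta> = sqrt (h * lo)"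
      "log 2 (h / lo) = 2 powr (2 * real k + 1 - real i)"
      "\<not> SD ((1 / 2) ^ (2 ^ k - 1)) \<or> \<not> CC (2 ^ (2 ^ k - 1))"
    unfolding bracket_def by blast
  then show ?case
  proof cases
    case A
    show ?thesis
    proof (cases "SD \<eta>")
      case False
      then show ?thesis using A by (simp add: step bracket_def del: power_Suc log_bisection.simps)
    next
      case True
      with fail have "\<not> CC \<eta>" by simp
      have "\<eta> > 0" using A by simp
      then have "\<eta> < (1 / 2) ^ (2 ^ i - 1)" using SD_less_not_SD[OF True A(3)] by simp
      then show ?thesis
        unfolding step bracket_def using True \<open>\<not> CC \<eta>\<close> \<open>\<eta> > 0\<close> A log2_power_gap(1)[of i]
        by (auto simp del: power_Suc of_nat_Suc intro!: exI[of _ i])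
    qed
  next
    case B
    have "lo > 0" "\<eta> > 0" using B by simp_all
    show ?thesis
    proof (cases "SD \<eta>")
      case False
      have "lo < \<eta>" using SD_less_not_SD[OF not_CC_imp_SD[OF B(3)] False] \<open>lo > 0\<close> \<open>\<eta> > 0\<close> by simp
      then show ?thesis
        unfolding step bracket_def using False \<open>lo > 0\<close> B log2_power_gap(2)[of i]
        by (auto simp del: power_Suc of_nat_Suc intro!: exI[of _ i])
    next
      case True
      with fail have "\<not> CC \<eta>" by simp
      then show ?thesis using True B by (simp add: step bracket_def del: power_Suc log_bisection.simps)
    qed
  next
    case C
    note mean = log2_geometric_mean[OF C(2,3), folded C(6)]
    have "\<eta> > 0" using mean C by simp
    show ?thesis
    proof (cases "SD \<eta>")
      case False
      then show ?thesis
        unfolding step bracket_def using mean C halve[OF C(7)]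
        by (auto simp del: power_Suc of_nat_Suc intro!: exI[of _ k])
    next
      case True
      with fail have "\<not> CC \<eta>" by simp
      then show ?thesis
        unfolding step bracket_def using True \<open>\<eta> > 0\<close> mean C halve[OF C(7)]
        by (auto simp del: power_Suc of_nat_Suc intro!: exI[of _ k])
    qed
  qed
qed

text \<open>
  The summand \<open>1\<close> on the left saves one loop in the final count; it is available because of the factor
  \<open>3 / 2\<close> in the scale bound, whose square is at least \<open>2\<close>.
\<close>
lemma log2_scale_bound_witness:
  assumes "\<not> SD ((1 / 2) ^ (2 ^ k - 1)) \<or> \<not> CC (2 ^ (2 ^ k - 1))"
  shows "2 * real k + 1 \<le> 2 * log 2 scale_bound"
proof -
  have "3 / 2 * (real (2 ^ k - 1) + 1) \<le> scale_bound"
    by (rule trial_exponent_le_scale_bound[OF assms])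
  then have "3 / 2 * 2 ^ k \<le> scale_bound" by (simp add: of_nat_diff)
  then have "log 2 (3 / 2 * 2 ^ k) \<le> log 2 scale_bound"
    using scale_bound_ge_3 by (subst log_le_cancel_iff) auto
  moreover have "log 2 (3 / 2 * 2 ^ k) = log 2 (3 / 2) + real k"
    by (subst log_mult_pos) (simp_all add: log_nat_power)
  moreover have "log 2 2 \<le> log 2 ((3 / 2 :: real) ^ 2)"
    by (subst log_le_cancel_iff) (auto simp: power2_eq_square)
  then have "1 \<le> 2 * log 2 (3 / 2 :: real)" by (simp add: log_nat_power)
  ultimately show ?thesis by simp
qed

text \<open>
  Without a bracket, \<open>log2_scale_bound_witness\<close> applies to \<open>i\<close> itself. With a bracket, \<open>2 k + 1 - i\<close> is \<open>log 2\<close> of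
  its size in \<open>log 2\<close>, which is at least \<open>- log 2 spread_bound\<close>.
\<close>
lemma failing_loops_bound:
  assumes "\<And>j. j \<le> i \<Longrightarrow> \<not> returns_at f \<alpha> \<beta> x d j"
  shows "real i \<le> log 2 spread_bound + 2 * log 2 scale_bound"
proof -
  obtain \<eta> lo hi where st: "log_bisection f \<alpha> \<beta> x d (Suc i) = (\<eta>, lo, hi)"
    by (metis prod_cases3)
  have inv: "bracket i (\<eta>, lo, hi)" using bracket_invariant[OF assms] by (simp add: st[symmetric])
  have spread: "0 \<le> log 2 spread_bound" using spread_bound_ge_1 by simp
  from inv consider
    (first) "\<not> SD ((1 / 2) ^ (2 ^ i - 1)) \<or> \<not> CC (2 ^ (2 ^ i - 1))"
  | (second) h k where "0 < lo" "lo < h" "\<not> CC lo" "\<not> SD h"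
      "log 2 (h / lo) = 2 powr (2 * real k + 1 - real i)"
      "\<not> SD ((1 / 2) ^ (2 ^ k - 1)) \<or> \<not> CC (2 ^ (2 ^ k - 1))"
    unfolding bracket_def by blast
  then show ?thesis
  proof cases
    case first
    then show ?thesis using log2_scale_bound_witness[OF first] spread by simp
  next
    case second
    have "1 / spread_bound \<le> 2 powr (2 * real k + 1 - real i)"
      using log2_bracket_ge[OF second(4) _ second(3,1)] second by simp
    then have "log 2 (1 / spread_bound) \<le> log 2 (2 powr (2 * real k + 1 - real i))"
      using spread_bound_ge_1 by (subst log_le_cancel_iff) auto
    then have "- log 2 spread_bound \<le> 2 * real k + 1 - real i"
      using spread_bound_ge_1 by (simp add: log_divide_pos)
    then show ?thesis using log2_scale_bound_witness[OF second(6)] by simp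
  qed
qed

lemma terminates: "\<exists>i. returns_at f \<alpha> \<beta> x d i"
proof (rule ccontr)
  assume "\<nexists>i. returns_at f \<alpha> \<beta> x d i"
  then have "real i \<le> log 2 spread_bound + 2 * log 2 scale_bound" for i
    by (intro failing_loops_bound) auto
  then show False by (meson not_le reals_Archimedean2)
qed

lemma loops_bound:
  "\<exists>n. loops f \<alpha> \<beta> x d = enat n \<and> real n \<le> 2 + log 2 spread_bound + 2 * log 2 scale_bound"
proof -
  define n where "n = (LEAST i. returns_at f \<alpha> \<beta> x d i)"
  have "real n \<le> 1 + log 2 spread_bound + 2 * log 2 scale_bound"
  proof (cases n)
    case 0
    then show ?thesis using spread_bound_ge_1 scale_bound_ge_3 by simp
  next
    case (Suc i)
    have "real i \<le> log 2 spread_bound + 2 * log 2 scale_bound"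
      using Suc not_less_Least[of _ "returns_at f \<alpha> \<beta> x d"] unfolding n_def
      by (intro failing_loops_bound) (metis le_imp_less_Suc)
    then show ?thesis using Suc by simp
  qed
  moreover have "loops f \<alpha> \<beta> x d = enat (Suc n)"
    using terminates by (simp add: loops_def n_def)
  ultimately show ?thesis by (intro exI[of _ "Suc n"]) simp
qed

lemma step_size_properties:
  shows "SD (step_size f \<alpha> \<beta> x d)" "CC (step_size f \<alpha> \<beta> x d)" "step_size f \<alpha> \<beta> x d > 0"
proof -
  define n where "n = (LEAST i. returns_at f \<alpha> \<beta> x d i)"
  have "returns_at f \<alpha> \<beta> x d n" unfolding n_def using terminates by (rule LeastI_ex)
  then show "SD (step_size f \<alpha> \<beta> x d)" "CC (step_size f \<alpha> \<beta> x d)"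
    by (auto simp: returns_at_def step_size_def n_def)
  have "trial_step f \<alpha> \<beta> x d n > 0"
  proof (cases n)
    case 0
    then show ?thesis by (simp add: trial_step_def)
  next
    case (Suc i)
    obtain \<eta> lo hi where st: "log_bisection f \<alpha> \<beta> x d (Suc i) = (\<eta>, lo, hi)"
      by (metis prod_cases3)
    have "bracket i (log_bisection f \<alpha> \<beta> x d (Suc i))"
      using Suc not_less_Least[of _ "returns_at f \<alpha> \<beta> x d"] unfolding n_def
      by (intro bracket_invariant) (metis le_imp_less_Suc)
    then show ?thesis
      unfolding trial_step_def Suc st by (auto simp: bracket_def)
  qed
  then show "step_size f \<alpha> \<beta> x d > 0" by (simp add: step_size_def n_def)
qed

end

section \<open>The BFGS iterates\<close>

locale bfgs_run = smooth_strongly_convex f \<mu> L M xstar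
  for f :: "real^'n \<Rightarrow> real" and \<mu> L M :: real and xstar :: "real^'n" +
  fixes \<alpha> \<beta> :: real and x :: "nat \<Rightarrow> real^'n" and B :: "nat \<Rightarrow> real^'n^'n"
  assumes \<alpha>_pos: "0 < \<alpha>" and \<alpha>_less_\<beta>: "\<alpha> < \<beta>" and \<beta>_less_1: "\<beta> < 1" and \<alpha>_less_half: "\<alpha> < 1 / 2"
    and spd_B0: "spd (B 0)" and run: "bfgs_log_bisection f \<alpha> \<beta> x B"
    and grad_nonzero: "\<And>k. grad f (x k) \<noteq> 0"
begin

abbreviation dir :: "nat \<Rightarrow> real^'n" where "dir k \<equiv> direction f (x k) (B k)"
abbreviation step :: "nat \<Rightarrow> real" where "step k \<equiv> step_size f \<alpha> \<beta> (x k) (dir k)"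
abbreviation s :: "nat \<Rightarrow> real^'n" where "s k \<equiv> x (Suc k) - x k"
abbreviation y :: "nat \<Rightarrow> real^'n" where "y k \<equiv> grad f (x (Suc k)) - grad f (x k)"

lemma s_eq: "s k = step k *\<^sub>R dir k"
  using run by (simp add: bfgs_log_bisection_def)

lemma B_Suc: "B (Suc k) = bfgs_update (B k) (s k) (y k)"
  using run by (simp add: bfgs_log_bisection_def)

lemma line_search_dir:
  assumes "spd (B k)"
  shows "line_search f \<mu> L M xstar \<alpha> \<beta> (x k) (dir k)"
proof unfold_locales
  show "grad f (x k) \<bullet> dir k < 0"
    using spd_matrix_inv[OF assms] grad_nonzero[of k] by (simp add: direction_def spd_def)
qed (fact \<alpha>_pos \<alpha>_less_\<beta> \<beta>_less_1 \<alpha>_less_half)+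

lemma step_facts:
  assumes "spd (B k)"
  shows "step k > 0" "grad f (x k) \<bullet> s k < 0"
    "f (x (Suc k)) \<le> f (x k) + \<alpha> * (grad f (x k) \<bullet> s k)"
    "- (1 - \<beta>) * (grad f (x k) \<bullet> s k) \<le> s k \<bullet> y k"
    "B k *v s k = - (step k *\<^sub>R grad f (x k))"
proof -
  interpret line_search f \<mu> L M xstar \<alpha> \<beta> "x k" "dir k"
    by (rule line_search_dir[OF assms])
  note props = step_size_properties
  show pos: "step k > 0" by (rule props)
  show neg: "grad f (x k) \<bullet> s k < 0" using pos descent by (simp add: s_eq mult_pos_neg)
  have x_Suc: "x (Suc k) = x k + step k *\<^sub>R dir k" using s_eq[of k] by (simp add: algebra_simps)
  show "f (x (Suc k)) \<le> f (x k) + \<alpha> * (grad f (x k) \<bullet> s k)"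
    using props(1) by (simp add: sufficient_decrease_def s_eq x_Suc mult.assoc)
  have "step k * (\<beta> * (grad f (x k) \<bullet> dir k)) \<le> step k * (grad f (x (Suc k)) \<bullet> dir k)"
    using props(2) pos by (intro mult_left_mono) (auto simp: curvature_condition_def x_Suc)
  then show "- (1 - \<beta>) * (grad f (x k) \<bullet> s k) \<le> s k \<bullet> y k"
    by (simp add: s_eq inner_diff_right inner_commute algebra_simps)
  show "B k *v s k = - (step k *\<^sub>R grad f (x k))"
    unfolding s_eq matrix_vector_mult_scaleR direction_def
    using matrix_inv_vec(1)[OF spd_invertible[OF assms]]
    by (simp add: matrix_vector_mult_diff_distrib[of _ 0, simplified])
qed

lemma s_dot_y_pos:
  assumes "spd (B k)"
  shows "s k \<bullet> y k > 0"
proof -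
  have "0 < - (1 - \<beta>) * (grad f (x k) \<bullet> s k)"
    using step_facts(2)[OF assms] \<beta>_less_1 by (intro mult_neg_neg) auto
  then show ?thesis using step_facts(4)[OF assms] by linarith
qed

lemma spd_B: "spd (B k)"
proof (induction k)
  case (Suc k)
  then show ?case unfolding B_Suc by (intro spd_bfgs_update s_dot_y_pos)
qed (fact spd_B0)

lemmas run_step_facts = step_facts[OF spd_B] and run_s_dot_y_pos = s_dot_y_pos[OF spd_B]

lemma s_B_s: "s k \<bullet> (B k *v s k) = - step k * (grad f (x k) \<bullet> s k)"
  by (simp add: run_step_facts(5) inner_commute)

lemma s_B_s_pos: "s k \<bullet> (B k *v s k) > 0"
  unfolding s_B_s using run_step_facts(1,2)[of k] by (simp add: mult_pos_neg)

lemma decreasing: "f (x (Suc k)) \<le> f (x k)"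
  using run_step_facts(3)[of k] mult_pos_neg[OF \<alpha>_pos run_step_facts(2)[of k]] by linarith

lemma f_le_f0: "f (x k) \<le> f (x 0)"
  using decreasing by (rule lift_Suc_antimono_le[where f = "\<lambda>k. f (x k)"]) simp

lemma segment_sublevel:
  assumes "0 \<le> \<xi>" "\<xi> \<le> 1"
  shows "f (x k + \<xi> *\<^sub>R s k) \<le> f (x k)"
proof (rule sublevel_segment[OF _ assms])
  show "f (x k + 1 *\<^sub>R s k) \<le> f (x k)" using decreasing by simp
qed

subsection \<open>Linear convergence and the sum of the deviations\<close>

definition gap :: "nat \<Rightarrow> real" where "gap k = f (x k) - f xstar"

lemma gap_nonneg: "gap k \<ge> 0" using minimizer by (simp add: gap_def)

definition rate :: real where "rate = 2 * \<alpha> * (1 - \<beta>) * \<mu> / L"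

lemma rate_pos: "rate > 0"
  using \<alpha>_pos \<beta>_less_1 \<mu>_pos L_pos by (simp add: rate_def)

text \<open>
  Let \<open>q = (norm g)\<^sup>2 (s \<bullet> y) / (L (g \<bullet> s)\<^sup>2)\<close>. The Armijo-Wolfe conditions and the
  Polyak-Lojasiewicz inequality give a relative decrease of at least \<open>rate / q\<close>. The potential with weight
  \<open>1 / L\<close> grows by at most \<open>- ln q\<close>, because \<open>(norm y)\<^sup>2 \<le> L (s \<bullet> y)\<close>, and \<open>- ln q \<le> 1 / q - 1\<close>.
\<close>
lemma gap_Suc_le:
  "gap (Suc k) \<le> exp (- rate * (1 + \<Psi> ((1 / L) *\<^sub>R B (Suc k)) - \<Psi> ((1 / L) *\<^sub>R B k))) * gap k"
proof -
  define g where "g = grad f (x k)"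
  define gs where "gs = - (g \<bullet> s k)"
  have gs: "gs > 0" using run_step_facts(2)[of k] by (simp add: gs_def g_def)
  define sy where "sy = s k \<bullet> y k"
  have sy: "sy > 0" using run_s_dot_y_pos by (simp add: sy_def)
  define b where "b = s k \<bullet> (B k *v s k)"
  have b: "b > 0" "b = step k * gs"
    using s_B_s_pos s_B_s by (auto simp: b_def gs_def g_def)
  have st: "step k > 0" by (rule run_step_facts)
  have g: "norm g > 0" using grad_nonzero by (simp add: g_def)
  define \<psi> where "\<psi> j = \<Psi> ((1 / L) *\<^sub>R B j)" for j
  define r where "r = (norm (B k *v s k))\<^sup>2 / (L * b)"
  have r_eq: "r = step k * (norm g)\<^sup>2 / (L * gs)"
    using st by (simp add: r_def run_step_facts(5) b(2) g_def power_mult_distrib power2_eq_square)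
  have r: "r > 0" unfolding r_eq using st g gs L_pos by simp
  define q where "q = r * (sy / b)"
  have q: "q > 0" using r sy b by (simp add: q_def)
  have q_eq: "q = (norm g)\<^sup>2 * sy / (L * gs\<^sup>2)"
    using st by (simp add: q_def r_eq b(2) power2_eq_square)
  have "\<psi> (Suc k) = \<psi> k - r + (norm (y k))\<^sup>2 / (L * sy) - ln (sy / b)"
  proof -
    define S R :: "real^'n^'n" where "S = (1 / sqrt L) *\<^sub>R mat 1" and "R = sqrt L *\<^sub>R mat 1"
    have SR: "S ** R = mat 1"
      using L_pos unfolding matrix_eq by (simp add: S_def R_def flip: matrix_vector_mul_assoc scaleR_matrix_vector_assoc)
    have "spd S"
      using L_pos by (simp add: S_def spd_def transpose_scalar flip: scaleR_matrix_vector_assoc)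
    have SAS: "S ** A ** S = (1 / L) *\<^sub>R A" for A
      using L_pos unfolding matrix_eq
      by (simp add: S_def matrix_vector_mult_scaleR flip: matrix_vector_mul_assoc scaleR_matrix_vector_assoc)
    have nS: "(norm (S *v v))\<^sup>2 = (norm v)\<^sup>2 / L" for v
      using L_pos by (simp add: S_def power_divide flip: scaleR_matrix_vector_assoc)
    show ?thesis
      using \<Psi>_congruence_bfgs_update[OF spd_B[of k] \<open>spd S\<close> SR run_s_dot_y_pos[of k]]
      unfolding SAS nS B_Suc[symmetric] by (simp add: \<psi>_def r_def b_def sy_def)
  qed
  moreover have "(norm (y k))\<^sup>2 \<le> L * sy"
  proof -
    have "(grad f (x k + s k) - grad f (x k)) \<bullet> (mat 1 *v (grad f (x k + s k) - grad f (x k)))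
      \<le> L * (s k \<bullet> (grad f (x k + s k) - grad f (x k)))"
      using hess_upper L_pos by (intro grad_difference_bound[of "mat 1"]) (auto simp: power2_norm_eq_inner)
    then show ?thesis by (simp add: power2_norm_eq_inner sy_def)
  qed
  then have "(norm (y k))\<^sup>2 / (L * sy) \<le> 1" using L_pos sy by simp
  ultimately have "1 + \<psi> (Suc k) - \<psi> k \<le> 1 - (r - 1) - ln (sy / b)" by simp
  also have "\<dots> \<le> 1 - ln r - ln (sy / b)" using ln_le_minus_one[OF r] by simp
  also have "\<dots> = 1 - ln q" using r sy b by (simp add: q_def ln_mult_pos del: times_divide_eq_right)
  also have "\<dots> \<le> 1 / q"
    using ln_le_minus_one[of "1 / q"] q by (simp add: ln_div)
  finally have potential: "1 + \<psi> (Suc k) - \<psi> k \<le> 1 / q" .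
  have "rate * (1 / q) * gap k = \<alpha> * (1 - \<beta>) * gs\<^sup>2 / ((norm g)\<^sup>2 * sy) * (2 * \<mu> * gap k)"
    using L_pos by (simp add: rate_def q_eq)
  also have "\<dots> \<le> \<alpha> * (1 - \<beta>) * gs\<^sup>2 / ((norm g)\<^sup>2 * sy) * (norm g)\<^sup>2"
    using polyak_lojasiewicz[of "x k"] \<alpha>_pos \<beta>_less_1 sy
    by (intro mult_left_mono) (auto simp: gap_def g_def)
  also have "\<dots> = \<alpha> * gs * ((1 - \<beta>) * gs / sy)"
    using g by (simp add: power2_eq_square)
  also have "\<dots> \<le> \<alpha> * gs * 1"
  proof (rule mult_left_mono)
    have "(1 - \<beta>) * gs \<le> sy" 
      using run_step_facts(4)[of k] unfolding gs_def g_def sy_def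
      by (simp only: mult_minus_left mult_minus_right)
    then show "(1 - \<beta>) * gs / sy \<le> 1" using sy by simp
  qed (use \<alpha>_pos gs in simp)
  also have "\<dots> \<le> gap k - gap (Suc k)"
    using run_step_facts(3)[of k] by (simp add: gap_def gs_def g_def)
  finally have "gap (Suc k) \<le> (1 + (- rate * (1 / q))) * gap k" by (simp add: algebra_simps)
  also have "\<dots> \<le> exp (- rate * (1 / q)) * gap k"
    using gap_nonneg by (intro mult_right_mono exp_ge_add_one_self)
  also have "\<dots> \<le> exp (- rate * (1 + \<psi> (Suc k) - \<psi> k)) * gap k"
    using mult_left_mono[OF potential less_imp_le[OF rate_pos]]
    by (intro mult_right_mono gap_nonneg) simp
  finally show ?thesis by (simp add: \<psi>_def)
qed

lemma spd_scaled_B: "spd ((1 / L) *\<^sub>R B k)"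
  using spd_B[of k] L_pos by (simp add: spd_def transpose_scalar flip: scaleR_matrix_vector_assoc)

text \<open>
  The potential differences telescope and the final potential is nonnegative.
\<close>
lemma gap_le_exp: "gap k \<le> exp (- rate * (real k - \<Psi> ((1 / L) *\<^sub>R B 0))) * gap 0"
proof -
  define \<psi> where "\<psi> j = \<Psi> ((1 / L) *\<^sub>R B j)" for j
  have "gap k \<le> exp (- rate * (real k + \<psi> k - \<psi> 0)) * gap 0"
  proof (induction k)
    case (Suc k)
    have "gap (Suc k) \<le> exp (- rate * (1 + \<psi> (Suc k) - \<psi> k)) * gap k"
      unfolding \<psi>_def by (rule gap_Suc_le)
    also have "\<dots> \<le> exp (- rate * (1 + \<psi> (Suc k) - \<psi> k)) * (exp (- rate * (real k + \<psi> k - \<psi> 0)) * gap 0)"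
      by (intro mult_left_mono Suc) auto
    also have "\<dots> = exp (- rate * (1 + \<psi> (Suc k) - \<psi> k) + - rate * (real k + \<psi> k - \<psi> 0)) * gap 0"
      by (simp only: exp_add mult.assoc)
    also have "- rate * (1 + \<psi> (Suc k) - \<psi> k) + - rate * (real k + \<psi> k - \<psi> 0)
        = - rate * (real (Suc k) + \<psi> (Suc k) - \<psi> 0)"
      by (simp add: algebra_simps)
    finally show ?case .
  qed simp
  also have "\<dots> \<le> exp (- rate * (real k - \<psi> 0)) * gap 0"
    using rate_pos gap_nonneg \<Psi>_nonneg[OF spd_scaled_B[of k]] by (intro mult_right_mono) (auto simp: \<psi>_def)
  finally show ?thesis by (simp add: \<psi>_def)
qed

text \<open>
  The deviation is the square root of the gap up to a constant, so it never exceeds its initial value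
  and decays at half the rate. The summand \<open>2\<close> of \<open>sum_capped_exponential_le\<close> is absorbed because
  \<open>\<alpha> (1 - \<beta>) \<mu> \<le> L\<close>.
\<close>
lemma sum_deviation_le:
  "(\<Sum>i<t. deviation (x i)) \<le> (\<Psi> ((1 / L) *\<^sub>R B 0) + 3 / (\<alpha> * (1 - \<beta>)) * (L / \<mu>)) * deviation (x 0)"
proof -
  define P where "P = \<Psi> ((1 / L) *\<^sub>R B 0)"
  have P: "P \<ge> 0" unfolding P_def by (intro \<Psi>_nonneg spd_scaled_B)
  define e where "e i = min 1 (exp (- (rate / 2) * (real i - P)))" for i
  have dev: "deviation (x i) = M / \<mu> powr (3 / 2) * sqrt (2 * gap i)" for i
    by (simp add: deviation_def gap_def)
  have "deviation (x i) \<le> e i * deviation (x 0)" for i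
  proof -
    have "sqrt (2 * gap i) \<le> sqrt (2 * gap 0)"
      using f_le_f0[of i] by (simp add: gap_def)
    moreover have "sqrt (2 * gap i) \<le> exp (- (rate / 2) * (real i - P)) * sqrt (2 * gap 0)"
    proof (rule real_le_lsqrt)
      have "2 * gap i \<le> 2 * (exp (- rate * (real i - P)) * gap 0)"
        using gap_le_exp[of i] by (simp add: P_def)
      also have "exp (- rate * (real i - P)) = (exp (- (rate / 2) * (real i - P)))\<^sup>2"
        by (simp flip: exp_double) 
      finally show "2 * gap i \<le> (exp (- (rate / 2) * (real i - P)) * sqrt (2 * gap 0))\<^sup>2"
        using gap_nonneg[of 0] by (simp add: power_mult_distrib)
    qed (use gap_nonneg in auto)
    ultimately have "sqrt (2 * gap i) \<le> e i * sqrt (2 * gap 0)"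
      by (simp add: e_def min_def)
    then have "M / \<mu> powr (3 / 2) * sqrt (2 * gap i) \<le> M / \<mu> powr (3 / 2) * (e i * sqrt (2 * gap 0))"
      using M_pos by (intro mult_left_mono) auto
    then show ?thesis by (simp add: dev mult_ac)
  qed
  then have "(\<Sum>i<t. deviation (x i)) \<le> (\<Sum>i<t. e i * deviation (x 0))"
    by (rule sum_mono)
  also have "\<dots> = (\<Sum>i<t. e i) * deviation (x 0)" by (simp add: sum_distrib_right)
  also have "\<dots> \<le> (P + 2 + 1 / (rate / 2)) * deviation (x 0)"
    using rate_pos P deviation_nonneg
    by (intro mult_right_mono sum_capped_exponential_le) (auto simp: e_def)
  also have "\<dots> \<le> (P + 3 / (\<alpha> * (1 - \<beta>)) * (L / \<mu>)) * deviation (x 0)"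
  proof (intro mult_right_mono deviation_nonneg)
    have "\<alpha> * (1 - \<beta>) * \<mu> \<le> 1 * 1 * L"
      using \<alpha>_pos \<alpha>_less_\<beta> \<beta>_less_1 \<mu>_pos \<mu>_le_L by (intro mult_mono) auto
    then have "1 \<le> L / (\<alpha> * (1 - \<beta>) * \<mu>)"
      using \<alpha>_pos \<beta>_less_1 \<mu>_pos by (simp add: field_simps)
    moreover have "1 / (rate / 2) = L / (\<alpha> * (1 - \<beta>) * \<mu>)" by (simp add: rate_def)
    moreover have "3 / (\<alpha> * (1 - \<beta>)) * (L / \<mu>) = 3 * (L / (\<alpha> * (1 - \<beta>) * \<mu>))" by simp
    ultimately show "P + 2 + 1 / (rate / 2) \<le> P + 3 / (\<alpha> * (1 - \<beta>)) * (L / \<mu>)" by linarith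
  qed
  finally show ?thesis by (simp add: P_def)
qed

subsection \<open>The potential relative to the Hessian at the minimizer\<close>

definition Btilde :: "nat \<Rightarrow> real^'n^'n" where
  "Btilde k = inv_sqrt (hess f xstar) ** B k ** inv_sqrt (hess f xstar)"

abbreviation ratio :: "nat \<Rightarrow> real" where
  "ratio k \<equiv> line_search.\<rho> f xstar (x k) (dir k)"

lemma spd_Btilde: "spd (Btilde k)"
  unfolding Btilde_def by (intro spd_congruence spd_B inv_sqrt_spd hess_spd)

lemma ratio_eq: "ratio k = (s k \<bullet> (B k *v s k)) / (s k \<bullet> (hess f xstar *v s k))"
proof -
  interpret line_search f \<mu> L M xstar \<alpha> \<beta> "x k" "dir k"
    by (rule line_search_dir[OF spd_B])
  have st: "step k > 0" by (rule run_step_facts)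
  have "s k \<bullet> (B k *v s k) = (step k)\<^sup>2 * initial_descent"
    unfolding s_B_s by (simp add: s_eq initial_descent_def power2_eq_square)
  moreover have "s k \<bullet> (hess f xstar *v s k) = (step k)\<^sup>2 * (dir k \<bullet> (hess f xstar *v dir k))"
    by (simp add: s_eq matrix_vector_mult_scaleR power2_eq_square)
  ultimately show ?thesis using st by (simp add: \<rho>_def)
qed

text \<open>
  In the coordinates in which the Hessian at the minimizer is the identity, \<open>ratio k\<close> is the Rayleigh
  quotient of \<open>B\<close> at \<open>s\<close>. In the formula for the potential, the first fraction is at least \<open>ratio k\<close> by
  Cauchy-Schwarz, the second is at most \<open>1 + C\<close>, and the logarithm contributes at most \<open>ln (ratio k)\<close> plus
  \<open>ln (1 + C) \<le> C\<close>.
\<close>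
lemma \<Psi>_Btilde_Suc:
  "ratio k - 1 - ln (ratio k) \<le> \<Psi> (Btilde k) - \<Psi> (Btilde (Suc k)) + 2 * deviation (x k)"
proof -
  define H where "H = hess f xstar"
  define S where "S = inv_sqrt H"
  define R where "R = matrix_inv S"
  define C where "C = deviation (x k)"
  have C: "C \<ge> 0" by (simp add: C_def deviation_nonneg)
  have H: "spd H" by (simp add: H_def hess_spd)
  have S: "spd S" and SS: "S ** S = matrix_inv H"
    using inv_sqrt_spd[OF H] by (auto simp: S_def)
  note SR = matrix_inv_inverse(1)[OF spd_invertible[OF S], folded R_def]
  have R: "spd R" unfolding R_def by (rule spd_matrix_inv[OF S])
  have symS: "transpose S = S" and symR: "transpose R = R" using S R by (auto simp: spd_def)
  have SRv: "S *v (R *v v) = v" for v using SR by (simp add: matrix_vector_mul_assoc)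
  have SSv: "S *v (S *v v) = matrix_inv H *v v" for v by (simp add: matrix_vector_mul_assoc SS)
  note invH = matrix_inv_vec[OF spd_invertible[OF H]]
  have RR: "R *v (R *v v) = H *v v" for v
    using SSv[of "R *v (R *v v)"] by (metis SRv invH(1))
  define b where "b = s k \<bullet> (B k *v s k)"
  have b: "b > 0" by (simp add: b_def s_B_s_pos)
  define h where "h = s k \<bullet> (H *v s k)"
  have "s k \<noteq> 0" using run_s_dot_y_pos[of k] by auto
  then have h: "h > 0" using H by (simp add: h_def spd_def)
  have nR: "(norm (R *v s k))\<^sup>2 = h"
    by (simp add: power2_norm_eq_inner h_def RR flip: symmetric_dot[OF symR])
  define sy where "sy = s k \<bullet> y k"
  have sy: "sy > 0" by (simp add: sy_def run_s_dot_y_pos)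
  have ratio: "ratio k = b / h" by (simp add: ratio_eq b_def h_def H_def)
  have "b / h \<le> (norm (S *v (B k *v s k)))\<^sup>2 / b"
  proof -
    have "b = (R *v s k) \<bullet> (S *v (B k *v s k))"
      by (simp add: b_def symmetric_dot[OF symS] SRv)
    then have "b\<^sup>2 \<le> h * (norm (S *v (B k *v s k)))\<^sup>2"
      using Cauchy_Schwarz_ineq[of "R *v s k" "S *v (B k *v s k)"] by (simp add: nR[symmetric] power2_norm_eq_inner)
    then show ?thesis using b h by (simp add: field_simps power2_eq_square)
  qed
  moreover have "(norm (S *v y k))\<^sup>2 / sy \<le> 1 + C"
  proof -
    have "(grad f (x k + s k) - grad f (x k)) \<bullet> (matrix_inv H *v (grad f (x k + s k) - grad f (x k)))
      \<le> (1 + C) * (s k \<bullet> (grad f (x k + s k) - grad f (x k)))"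
    proof (rule grad_difference_bound[OF matrix_inv_inverse(1)[OF spd_invertible[OF H]]])
      show "u \<bullet> (hess f (x k + \<xi> *\<^sub>R s k) *v u) \<le> (1 + C) * (u \<bullet> (H *v u))" if "0 \<le> \<xi>" "\<xi> \<le> 1" for \<xi> u
        unfolding C_def H_def using segment_sublevel[OF that] by (rule hess_compare_xstar)
    qed (use C in auto)
    then have "y k \<bullet> (matrix_inv H *v y k) \<le> (1 + C) * sy" by (simp add: sy_def)
    moreover have "(norm (S *v y k))\<^sup>2 = y k \<bullet> (matrix_inv H *v y k)"
      by (simp only: power2_norm_eq_inner SSv flip: symmetric_dot[OF symS])
    ultimately show ?thesis using sy by (simp add: field_simps)
  qed
  moreover have "- ln (sy / b) \<le> C + ln (b / h)"
  proof -
    have "h / (1 + C) \<le> s k \<bullet> (grad f (x k + s k) - grad f (x k))"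
    proof (rule grad_difference_lower)
      fix \<xi> :: real assume "0 \<le> \<xi>" "\<xi> \<le> 1"
      then have "h \<le> (1 + C) * (s k \<bullet> (hess f (x k + \<xi> *\<^sub>R s k) *v s k))"
        unfolding h_def C_def H_def by (intro hess_compare_xstar segment_sublevel)
      then show "h / (1 + C) \<le> s k \<bullet> (hess f (x k + \<xi> *\<^sub>R s k) *v s k)"
        using C by (simp add: field_simps)
    qed
    then have "h \<le> sy * (1 + C)" using C by (simp add: sy_def field_simps)
    then have "ln h \<le> ln (sy * (1 + C))" using h sy C by (subst ln_le_cancel_iff) auto
    also have "\<dots> = ln sy + ln (1 + C)" using sy C by (intro ln_mult_pos) auto
    also have "\<dots> \<le> ln sy + C" using ln_add_one_self_le_self[OF C] by (simp add: add.commute)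
    finally show ?thesis using b h sy by (simp add: ln_div)
  qed
  ultimately have "\<Psi> (Btilde (Suc k)) \<le> \<Psi> (Btilde k) - b / h + (1 + C) + (C + ln (b / h))"
    using \<Psi>_congruence_bfgs_update[OF spd_B[of k] S SR run_s_dot_y_pos[of k]]
    unfolding Btilde_def B_Suc[symmetric] S_def[unfolded H_def, symmetric] b_def[symmetric] sy_def[symmetric]
    by linarith
  then show ?thesis by (simp add: ratio C_def)
qed

lemma sum_ratio_gap_le:
  "(\<Sum>i<t. ratio i - 1 - ln (ratio i)) \<le> \<Psi> (Btilde 0) + 2 * (\<Sum>i<t. deviation (x i))"
proof -
  have "(\<Sum>i<t. ratio i - 1 - ln (ratio i))
    \<le> (\<Sum>i<t. \<Psi> (Btilde i) - \<Psi> (Btilde (Suc i)) + 2 * deviation (x i))"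
    by (intro sum_mono \<Psi>_Btilde_Suc)
  also have "\<dots> = \<Psi> (Btilde 0) - \<Psi> (Btilde t) + 2 * (\<Sum>i<t. deviation (x i))"
    using sum_lessThan_telescope'[of "\<lambda>i. \<Psi> (Btilde i)" t] by (simp add: sum.distrib sum_distrib_left)
  finally show ?thesis using \<Psi>_nonneg[OF spd_Btilde[of t]] by simp
qed

subsection \<open>The average number of loops\<close>

lemma loops_bound_at:
  "\<exists>n. loops f \<alpha> \<beta> (x k) (dir k) = enat n \<and>
     real n \<le> 2 + log 2 (1 + (1 - \<beta>) / (\<beta> - \<alpha>) * (1 + 2 * deviation (x k)))
       + 2 * log 2 (log 2 (16 * (1 - \<alpha>)) + log 2 (1 + deviation (x k)) + deviation (x k)
           + 5 * (ratio k - 1 - ln (ratio k)))"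
  and scale_pos: "0 < log 2 (16 * (1 - \<alpha>)) + log 2 (1 + deviation (x k)) + deviation (x k)
           + 5 * (ratio k - 1 - ln (ratio k))"
proof -
  interpret line_search f \<mu> L M xstar \<alpha> \<beta> "x k" "dir k"
    by (rule line_search_dir[OF spd_B])
  show "\<exists>n. loops f \<alpha> \<beta> (x k) (dir k) = enat n \<and>
     real n \<le> 2 + log 2 (1 + (1 - \<beta>) / (\<beta> - \<alpha>) * (1 + 2 * deviation (x k)))
       + 2 * log 2 (log 2 (16 * (1 - \<alpha>)) + log 2 (1 + deviation (x k)) + deviation (x k)
           + 5 * (ratio k - 1 - ln (ratio k)))"
    using loops_bound unfolding spread_bound_def scale_bound_def .
  show "0 < log 2 (16 * (1 - \<alpha>)) + log 2 (1 + deviation (x k)) + deviation (x k)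
           + 5 * (ratio k - 1 - ln (ratio k))"
    using scale_bound_ge_3 unfolding scale_bound_def by linarith
qed

text \<open>
  Jensen's inequality for each of the logarithms. The scale bound contains one deviation outside of the
  logarithms, and five gaps \<open>ratio i - 1 - ln (ratio i)\<close>, whose sum is at most \<open>\<Psi> (Btilde 0) + 2\<sigma>\<close>;
  together they make \<open>5 \<Psi> (Btilde 0) + 11\<sigma>\<close> at most.
\<close>
lemma avg_loops_bound:
  assumes t: "t \<ge> 1" and \<sigma>: "(\<Sum>i<t. deviation (x i)) \<le> \<sigma>"
  shows "avg_loops f \<alpha> \<beta> x B t \<le> ereal
    (2 + log 2 (1 + (1 - \<beta>) / (\<beta> - \<alpha>) + 2 * (1 - \<beta>) / (\<beta> - \<alpha>) * (\<sigma> / real t))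
       + 2 * log 2 (log 2 (16 * (1 - \<alpha>)) + log 2 (1 + \<sigma> / real t)
                    + (6 * \<Psi> (Btilde 0) + 12 * \<sigma>) / real t))"
proof -
  define K where "K = (1 - \<beta>) / (\<beta> - \<alpha>)"
  have K: "K \<ge> 0" using \<alpha>_less_\<beta> \<beta>_less_1 by (simp add: K_def)
  define C where "C i = deviation (x i)" for i
  have C: "C i \<ge> 0" for i by (simp add: C_def deviation_nonneg)
  define A where "A = log 2 (16 * (1 - \<alpha>))"
  define D where "D i = 1 + K * (1 + 2 * C i)" for i
  have D: "D i > 0" for i using K C[of i] by (simp add: D_def add_pos_nonneg)
  define Y where "Y i = A + log 2 (1 + C i) + C i + 5 * (ratio i - 1 - ln (ratio i))" for i
  have Y: "Y i > 0" for i using scale_pos[of i] by (simp add: Y_def A_def C_def)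
  define T where "T = real t"
  have T: "T > 0" using t by (simp add: T_def)
  have sumC: "(\<Sum>i<t. C i) \<le> \<sigma>" using \<sigma> by (simp add: C_def)
  have \<sigma>_nonneg: "0 \<le> \<sigma>" using sumC sum_nonneg[of "{..<t}" C] C by force
  obtain n where n: "\<And>i. loops f \<alpha> \<beta> (x i) (dir i) = enat (n i)"
    and n_le: "\<And>i. real (n i) \<le> 2 + log 2 (D i) + 2 * log 2 (Y i)"
    using loops_bound_at unfolding D_def Y_def A_def C_def K_def by metis
  have "avg_loops f \<alpha> \<beta> x B t = ereal ((\<Sum>i<t. real (n i)) / T)"
  proof -
    have "(\<Sum>i<t. enat (n i)) = enat (\<Sum>i<t. n i)"
      by (induction t) (auto simp: zero_enat_def)
    then show ?thesis using T by (simp add: avg_loops_def n T_def)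
  qed
  also have "(\<Sum>i<t. real (n i)) / T \<le> (\<Sum>i<t. 2 + log 2 (D i) + 2 * log 2 (Y i)) / T"
    using T n_le by (intro divide_right_mono sum_mono) auto
  also have "\<dots> = 2 + (\<Sum>i<t. log 2 (D i)) / T + 2 * ((\<Sum>i<t. log 2 (Y i)) / T)"
    using T by (simp add: sum.distrib add_divide_distrib T_def flip: sum_distrib_left)
  also have "\<dots> \<le> 2 + log 2 ((\<Sum>i<t. D i) / T) + 2 * log 2 ((\<Sum>i<t. Y i) / T)"
    using mean_log2_le_log2_mean[OF t, of D, OF D] mean_log2_le_log2_mean[OF t, of Y, OF Y]
    unfolding T_def by linarith
  also have "log 2 ((\<Sum>i<t. D i) / T) \<le> log 2 (1 + K + 2 * K * (\<sigma> / T))"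
  proof -
    have "(\<Sum>i<t. D i) = T * (1 + K) + 2 * K * (\<Sum>i<t. C i)"
    proof -
      have "D i = (1 + K) + 2 * K * C i" for i by (simp add: D_def algebra_simps)
      then show ?thesis by (simp add: sum.distrib T_def flip: sum_distrib_left)
    qed
    also have "\<dots> \<le> T * (1 + K) + 2 * K * \<sigma>"
      using sumC K by (intro add_left_mono mult_left_mono) auto
    finally have "(\<Sum>i<t. D i) / T \<le> (T * (1 + K) + 2 * K * \<sigma>) / T"
      using T by (intro divide_right_mono) auto
    also have "\<dots> = 1 + K + 2 * K * (\<sigma> / T)" using T by (simp add: add_divide_distrib)
    finally have le: "(\<Sum>i<t. D i) / T \<le> 1 + K + 2 * K * (\<sigma> / T)" .
    have pos: "0 < (\<Sum>i<t. D i) / T" unfolding T_def using t D by (rule mean_pos)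
    show ?thesis
      by (rule log_le_cancel_iff[THEN iffD2, OF _ pos order.strict_trans2[OF pos le] le]) simp
  qed
  also have "log 2 ((\<Sum>i<t. Y i) / T) \<le> log 2 (A + log 2 (1 + \<sigma> / T) + (6 * \<Psi> (Btilde 0) + 12 * \<sigma>) / T)"
  proof -
    have "(\<Sum>i<t. log 2 (1 + C i)) / T \<le> log 2 ((\<Sum>i<t. 1 + C i) / T)"
      unfolding T_def using C by (intro mean_log2_le_log2_mean t) (auto simp: add_pos_nonneg)
    also have "\<dots> \<le> log 2 (1 + \<sigma> / T)"
    proof -
      have "(\<Sum>i<t. 1 + C i) / T = 1 + (\<Sum>i<t. C i) / T"
        using T by (simp add: sum.distrib T_def add_divide_distrib)
      also have "\<dots> \<le> 1 + \<sigma> / T" using sumC T by (simp add: divide_right_mono)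
      finally have le: "(\<Sum>i<t. 1 + C i) / T \<le> 1 + \<sigma> / T" .
      have pos: "0 < (\<Sum>i<t. 1 + C i) / T"
        unfolding T_def using C by (intro mean_pos t) (auto simp: add_pos_nonneg)
      show ?thesis
        by (rule log_le_cancel_iff[THEN iffD2, OF _ pos order.strict_trans2[OF pos le] le]) simp
    qed
    finally have 1: "(\<Sum>i<t. log 2 (1 + C i)) / T \<le> log 2 (1 + \<sigma> / T)" .
    have 2: "(\<Sum>i<t. C i + 5 * (ratio i - 1 - ln (ratio i))) \<le> 6 * \<Psi> (Btilde 0) + 12 * \<sigma>"
    proof -
      have "(\<Sum>i<t. C i + 5 * (ratio i - 1 - ln (ratio i)))
          = (\<Sum>i<t. C i) + 5 * (\<Sum>i<t. ratio i - 1 - ln (ratio i))"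
        by (simp add: sum.distrib sum_distrib_left)
      then show ?thesis
        using sum_ratio_gap_le[of t] sumC \<sigma>_nonneg \<Psi>_nonneg[OF spd_Btilde[of 0]]
        unfolding C_def[symmetric] by linarith
    qed
    have "(\<Sum>i<t. Y i) / T = A + (\<Sum>i<t. log 2 (1 + C i)) / T
        + (\<Sum>i<t. C i + 5 * (ratio i - 1 - ln (ratio i))) / T"
      using T by (simp add: Y_def sum.distrib T_def add_divide_distrib add.assoc)
    also have "\<dots> \<le> A + log 2 (1 + \<sigma> / T) + (6 * \<Psi> (Btilde 0) + 12 * \<sigma>) / T"
      using 1 2 T by (intro add_mono divide_right_mono) auto
    finally have le: "(\<Sum>i<t. Y i) / T \<le> A + log 2 (1 + \<sigma> / T) + (6 * \<Psi> (Btilde 0) + 12 * \<sigma>) / T" .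
    have pos: "0 < (\<Sum>i<t. Y i) / T" unfolding T_def using t Y by (rule mean_pos)
    show ?thesis
      by (rule log_le_cancel_iff[THEN iffD2, OF _ pos order.strict_trans2[OF pos le] le]) simp
  qed
  finally show ?thesis by (simp add: K_def A_def T_def)
qed

end

theorem theorem7p1:
  fixes f :: "real ^ 'n \<Rightarrow> real"
    and x :: "nat \<Rightarrow> real ^ 'n" and xstar :: "real ^ 'n"
    and B :: "nat \<Rightarrow> real ^ 'n ^ 'n" and Bbar0 Btilde0 :: "real ^ 'n ^ 'n"
    and \<mu> L M \<alpha> \<beta> \<kappa> \<sigma> :: real and C :: "nat \<Rightarrow> real" and t :: nat
  assumes "twice_differentiable f"
    and "\<mu> > 0" and "strongly_convex \<mu> f"
    and "L > 0" and "L-lipschitz_on UNIV (grad f)"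
    and "M > 0" and "hessian_lipschitz M f"
    and "\<And>z. f xstar \<le> f z"
    and "0 < \<alpha>" and "\<alpha> < \<beta>" and "\<beta> < 1" and "\<alpha> < 1 / 2"
    and "spd (B 0)"
    and "bfgs_log_bisection f \<alpha> \<beta> x B"
    and "\<And>k. grad f (x k) \<noteq> 0"
    and "\<kappa> = L / \<mu>"
    and "Bbar0 = (1 / L) *\<^sub>R B 0"
    and "Btilde0 = inv_sqrt (hess f xstar) ** B 0 ** inv_sqrt (hess f xstar)"
    and "\<And>k. C k = M / \<mu> powr (3 / 2) * sqrt (2 * (f (x k) - f xstar))"
    and "\<sigma> = (\<Psi> Bbar0 + 3 / (\<alpha> * (1 - \<beta>)) * \<kappa>) * C 0"
    and "t \<ge> 1"
  shows "avg_loops f \<alpha> \<beta> x B t \<le> ereal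
    (2 + log 2 (1 + (1 - \<beta>) / (\<beta> - \<alpha>) + 2 * (1 - \<beta>) / (\<beta> - \<alpha>) * (\<sigma> / real t))
       + 2 * log 2 (log 2 (16 * (1 - \<alpha>)) + log 2 (1 + \<sigma> / real t)
                    + (6 * \<Psi> Btilde0 + 12 * \<sigma>) / real t))"
proof -
  interpret bfgs_run f \<mu> L M xstar \<alpha> \<beta> x B
    by unfold_locales (use assms in auto)
  have "Btilde0 = Btilde 0" using assms(18) by (simp add: Btilde_def)
  moreover have "(\<Sum>i<t. deviation (x i)) \<le> \<sigma>"
    using sum_deviation_le[of t] assms(16,17,19,20) by (simp add: deviation_def)
  ultimately show ?thesis using avg_loops_bound[OF \<open>t \<ge> 1\<close>] by simp
qed

end
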